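(* For every integer $n\ge 0$, there are at least $\left\lfloor \frac{1}{2\sqrt{2}}(1+\sqrt{2})^{n+1}\right\rfloor$ distinct $(n+2)$-planar-feasible vectors.
   Context: $\tau(G)$ is the number of spanning trees of a (multi)graph $G$ (parallel edges counted as distinct). For an edge $e$ of $G$, $G/e$ is the multigraph obtained by contracting $e$ and $G-e$ the graph obtained by deleting $e$. A vector $(t,u)^T$ of integers is $n$-planar-feasible if there exist a simple planar graph $G$ on at most $n$ vertices and an edge $e\in E(G)$ with $t=\tau(G/e)$ and $u=\tau(G-e)$. *)

theory Defs
  imports "HOL-Analysis.Analysis"
begin

(* Undirected multigraphs: edges are labels, so parallel edges are distinct elements of
   mg_edges; mg_ends sends an edge to its set of endpoints, a singleton for a loop. *)
record ('v, 'e) multigraph =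
  mg_verts :: "'v set"
  mg_edges :: "'e set"
  mg_ends :: "'e \<Rightarrow> 'v set"

definition wf_multigraph :: "('v, 'e) multigraph \<Rightarrow> bool" where
  "wf_multigraph G \<longleftrightarrow> finite (mg_verts G) \<and> finite (mg_edges G) \<and>
     (\<forall>e \<in> mg_edges G. mg_ends G e \<subseteq> mg_verts G \<and> card (mg_ends G e) \<in> {1, 2})"

definition simple_graph :: "('v, 'e) multigraph \<Rightarrow> bool" where
  "simple_graph G \<longleftrightarrow> wf_multigraph G \<and>
     (\<forall>e \<in> mg_edges G. card (mg_ends G e) = 2) \<and> inj_on (mg_ends G) (mg_edges G)"

definition delete_edge :: "('v, 'e) multigraph \<Rightarrow> 'e \<Rightarrow> ('v, 'e) multigraph" where
  "delete_edge G e = G\<lparr>mg_edges := mg_edges G - {e}\<rparr>"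

(* The vertices of G/e are the blocks of the partition of the vertices of G whose only
   possibly non-singleton block is the set of endpoints of e. *)
definition contract_vertex :: "('v, 'e) multigraph \<Rightarrow> 'e \<Rightarrow> 'v \<Rightarrow> 'v set" where
  "contract_vertex G e v = (if v \<in> mg_ends G e then mg_ends G e else {v})"

definition contract_edge :: "('v, 'e) multigraph \<Rightarrow> 'e \<Rightarrow> ('v set, 'e) multigraph" where
  "contract_edge G e =
     \<lparr>mg_verts = contract_vertex G e ` mg_verts G,
      mg_edges = mg_edges G - {e},
      mg_ends = (\<lambda>f. contract_vertex G e ` mg_ends G f)\<rparr>"

definition mg_adj :: "('v, 'e) multigraph \<Rightarrow> ('v \<times> 'v) set" where
  "mg_adj G = {(x, y). \<exists>e \<in> mg_edges G. mg_ends G e = {x, y}}"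

definition mg_connected :: "('v, 'e) multigraph \<Rightarrow> bool" where
  "mg_connected G \<longleftrightarrow> mg_verts G \<noteq> {} \<and>
     (\<forall>x \<in> mg_verts G. \<forall>y \<in> mg_verts G. (x, y) \<in> (mg_adj G)\<^sup>*)"

(* The cycle vs!0, es!0, vs!1, es!1, ..., back to vs!0. Length 1 is a loop and length 2 a
   pair of parallel edges. *)
definition mg_cycle :: "('v, 'e) multigraph \<Rightarrow> 'v list \<Rightarrow> 'e list \<Rightarrow> bool" where
  "mg_cycle G vs es \<longleftrightarrow> es \<noteq> [] \<and> length vs = length es \<and> distinct vs \<and> distinct es \<and>
     set es \<subseteq> mg_edges G \<and>
     (\<forall>i < length es. mg_ends G (es ! i) = {vs ! i, vs ! (Suc i mod length es)})"

definition mg_tree :: "('v, 'e) multigraph \<Rightarrow> bool" where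
  "mg_tree G \<longleftrightarrow> mg_connected G \<and> (\<nexists>vs es. mg_cycle G vs es)"

definition spanning_trees :: "('v, 'e) multigraph \<Rightarrow> 'e set set" where
  "spanning_trees G = {T. T \<subseteq> mg_edges G \<and> mg_tree (G\<lparr>mg_edges := T\<rparr>)}"

definition num_spanning_trees :: "('v, 'e) multigraph \<Rightarrow> nat" where
  "num_spanning_trees G = card (spanning_trees G)"

(* A drawing in the plane without crossings: p places the vertices and c draws the edges.
   A simple_path may be closed, which happens exactly for loops. *)
definition plane_drawing ::
  "('v, 'e) multigraph \<Rightarrow> ('v \<Rightarrow> real \<times> real) \<Rightarrow> ('e \<Rightarrow> real \<Rightarrow> real \<times> real) \<Rightarrow> bool" where
  "plane_drawing G p c \<longleftrightarrow> inj_on p (mg_verts G) \<and>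
     (\<forall>e \<in> mg_edges G. simple_path (c e) \<and>
        {pathstart (c e), pathfinish (c e)} = p ` mg_ends G e \<and>
        path_image (c e) \<inter> p ` mg_verts G = p ` mg_ends G e) \<and>
     (\<forall>e \<in> mg_edges G. \<forall>f \<in> mg_edges G. e \<noteq> f \<longrightarrow>
        path_image (c e) \<inter> path_image (c f) \<subseteq> p ` mg_ends G e \<inter> p ` mg_ends G f)"

definition planar :: "('v, 'e) multigraph \<Rightarrow> bool" where
  "planar G \<longleftrightarrow> (\<exists>p c. plane_drawing G p c)"

(* Labelling vertices and edges by natural numbers loses no finite graph up to isomorphism. *)
definition planar_feasible :: "nat \<Rightarrow> int \<times> int \<Rightarrow> bool" where
  "planar_feasible n v \<longleftrightarrow>
     (\<exists>(G :: (nat, nat) multigraph) e. simple_graph G \<and> planar G \<and> card (mg_verts G) \<le> n \<and>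
        e \<in> mg_edges G \<and>
        v = (int (num_spanning_trees (contract_edge G e)),
             int (num_spanning_trees (delete_edge G e))))"

end

theory Submission
  imports Defs "HOL-Library.Transitive_Closure_Table" "HOL-Library.Nat_Bijection"
begin

text \<open>
  The vector \<open>(t, u)\<close> of an edge \<open>e = xy\<close> counts the spanning trees with and without \<open>e\<close>. Join a new
  vertex \<open>z\<close> to \<open>x\<close> and \<open>y\<close>. Depending on whether \<open>e\<close> is kept and which edge is distinguished next,
  the vector becomes \<open>S(t, u) = (t + u, u)\<close> (delete \<open>e\<close>, take \<open>xz\<close>), \<open>P(t, u) = (2t + u, t + u)\<close>
  (keep \<open>e\<close>, take \<open>xz\<close>) or \<open>D(t, u) = (2t, t + 2u)\<close> (keep and take \<open>e\<close>); simplicity and planarity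
  are preserved.

  Starting from a single edge, with vector \<open>(1, 0)\<close>, let every vector reached with \<open>n\<close> new vertices
  have the successors \<open>S v\<close> and \<open>P v\<close> with one more vertex, and a third one \<open>Q v\<close> with two more vertices.
  The ratio \<open>t/u\<close> is at least 2 on the image of \<open>S\<close> and lies in \<open>[3/2, 2]\<close> on the image of \<open>P\<close>, so
  \<open>Q\<close> has to be injective with ratios below \<open>3/2\<close>. If \<open>t \<le> 2u\<close> then \<open>D (S v)\<close> has ratio at most \<open>6/5\<close>.
  If \<open>t > 2u > 0\<close> then \<open>v = S w\<close>, and \<open>P (D (D w))\<close>, which needs three new vertices after \<open>w\<close>, hence two
  after \<open>v\<close>, has its ratio in \<open>(4/3, 3/2)\<close>. The remaining vector \<open>(1, 0)\<close> is sent to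
  \<open>(4, 4) = D (P (1, 0))\<close>. The number of vectors obtained satisfies the Pell recurrence
  \<open>a (n + 2) = 2 a (n + 1) + a n\<close>.
\<close>

section \<open>Adjacency and reachability along a set of edges\<close>

text \<open>With the endpoint map and the edge set as separate arguments, one relation serves edge
  subsets, contractions and, with \<open>id\<close> as endpoint map, graphs whose edges are vertex
  sets.\<close>

definition adj_rel :: "('e \<Rightarrow> 'v set) \<Rightarrow> 'e set \<Rightarrow> ('v \<times> 'v) set" where
  "adj_rel ends T = {(x, y). \<exists>e \<in> T. ends e = {x, y}}"

lemma mg_adj_eq_adj_rel: "mg_adj G = adj_rel (mg_ends G) (mg_edges G)"
  by (simp add: mg_adj_def adj_rel_def)

lemma sym_adj_rel: "sym (adj_rel ends T)"
  by (auto simp: adj_rel_def sym_def insert_commute)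

lemma adj_rel_rtrancl_sym:
  "(x, y) \<in> (adj_rel ends T)\<^sup>* \<Longrightarrow> (y, x) \<in> (adj_rel ends T)\<^sup>*"
  using sym_rtrancl[OF sym_adj_rel] by (rule symD)

lemma adj_rel_mono: "S \<subseteq> T \<Longrightarrow> adj_rel ends S \<subseteq> adj_rel ends T"
  by (auto simp: adj_rel_def)

lemma adj_rel_rtrancl_mono:
  "S \<subseteq> T \<Longrightarrow> (x, y) \<in> (adj_rel ends S)\<^sup>* \<Longrightarrow> (x, y) \<in> (adj_rel ends T)\<^sup>*"
  by (meson adj_rel_mono rtrancl_mono subsetD)

lemma rtrancl_map_rtrancl:
  assumes "(x, y) \<in> r\<^sup>*" and "\<And>a b. (a, b) \<in> r \<Longrightarrow> (h a, h b) \<in> s\<^sup>*"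
  shows "(h x, h y) \<in> s\<^sup>*"
  using assms(1) by induction (auto intro: rtrancl_trans assms(2))

section \<open>Components and trees\<close>

abbreviation component :: "('e \<Rightarrow> 'v set) \<Rightarrow> 'e set \<Rightarrow> 'v \<Rightarrow> 'v set" where
  "component ends T x \<equiv> (adj_rel ends T)\<^sup>* `` {x}"

lemma component_eq_iff:
  "component ends T x = component ends T y \<longleftrightarrow> (x, y) \<in> (adj_rel ends T)\<^sup>*"
proof
  assume "component ends T x = component ends T y"
  then show "(x, y) \<in> (adj_rel ends T)\<^sup>*" by blast
next
  assume "(x, y) \<in> (adj_rel ends T)\<^sup>*"
  moreover from this have "(y, x) \<in> (adj_rel ends T)\<^sup>*" by (rule adj_rel_rtrancl_sym)
  ultimately show "component ends T x = component ends T y" by (auto intro: rtrancl_trans)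
qed

text \<open>Follow a walk step by step: before it uses \<open>f\<close> it stays in one old
  component, and once it has used \<open>f\<close> both its start and its current point lie in the
  components of the two ends of \<open>f\<close>.\<close>

lemma rtrancl_adj_rel_insert:
  assumes f: "ends f = {a, b}" and xy: "(x, y) \<in> (adj_rel ends (insert f T))\<^sup>*"
  shows "(x, y) \<in> (adj_rel ends T)\<^sup>* \<or>
    (x \<in> component ends T a \<union> component ends T b \<and> y \<in> component ends T a \<union> component ends T b)"
  using xy
proof induction
  case base
  then show ?case by simp
next
  case (step y z)
  have yz: "(y, z) \<in> adj_rel ends T \<or> {y, z} = {a, b}"
    using step.hyps(2) f by (auto simp: adj_rel_def)
  show ?case
  proof (cases "(y, z) \<in> adj_rel ends T")
    case True
    then show ?thesis using step.IH by (auto intro: rtrancl_into_rtrancl)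
  next
    case False
    with yz have e: "{y, z} = {a, b}" by simp
    then have z: "z \<in> component ends T a \<union> component ends T b"
      and "y = a \<or> y = b" by (auto simp: doubleton_eq_iff)
    then show ?thesis using step.IH adj_rel_rtrancl_sym[of x y ends T] by auto
  qed
qed

lemma adj_rel_insert_redundant:
  assumes f: "ends f = {a, b}" and ab: "(a, b) \<in> (adj_rel ends T)\<^sup>*"
  shows "(adj_rel ends (insert f T))\<^sup>* = (adj_rel ends T)\<^sup>*"
proof (intro equalityI subrelI)
  fix x y assume "(x, y) \<in> (adj_rel ends (insert f T))\<^sup>*"
  from rtrancl_adj_rel_insert[where ends = ends and f = f and a = a and b = b, OF f this] component_eq_iff[of ends T a b] ab
  show "(x, y) \<in> (adj_rel ends T)\<^sup>*"
    by (auto intro: rtrancl_trans adj_rel_rtrancl_sym)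
next
  fix x y assume "(x, y) \<in> (adj_rel ends T)\<^sup>*"
  then show "(x, y) \<in> (adj_rel ends (insert f T))\<^sup>*"
    by (rule adj_rel_rtrancl_mono[rotated]) auto
qed

lemma component_insert:
  assumes f: "ends f = {a, b}"
  shows "component ends (insert f T) x =
    (if x \<in> component ends T a \<union> component ends T b
     then component ends T a \<union> component ends T b else component ends T x)"
proof -
  let ?R = "(adj_rel ends T)\<^sup>*" and ?R' = "(adj_rel ends (insert f T))\<^sup>*"
  let ?A = "component ends T a" and ?B = "component ends T b"
  have mono: "(u, v) \<in> ?R'" if "(u, v) \<in> ?R" for u v
    using that by (rule adj_rel_rtrancl_mono[rotated]) auto
  have "(a, b) \<in> ?R'" using f by (auto simp: adj_rel_def)
  then have ab: "(a, b) \<in> ?R'" "(b, a) \<in> ?R'" by (auto intro: adj_rel_rtrancl_sym)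
  show ?thesis
  proof (cases "x \<in> ?A \<union> ?B")
    case True
    have xa: "(x, a) \<in> ?R'"
      using True mono ab by (auto intro: adj_rel_rtrancl_sym rtrancl_trans)
    have "?A \<union> ?B \<subseteq> component ends (insert f T) x"
      using xa ab mono by (auto intro: rtrancl_trans)
    moreover have "component ends (insert f T) x \<subseteq> ?A \<union> ?B"
      using rtrancl_adj_rel_insert[where ends = ends and f = f and a = a and b = b and x = x, OF f] True by (auto intro: rtrancl_trans)
    ultimately show ?thesis using True by auto
  next
    case False
    then show ?thesis
      using rtrancl_adj_rel_insert[where ends = ends and f = f and a = a and b = b and x = x, OF f] mono by auto
  qed
qed

definition num_components :: "'v set \<Rightarrow> ('e \<Rightarrow> 'v set) \<Rightarrow> 'e set \<Rightarrow> nat" where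
  "num_components V ends T = card (component ends T ` V)"

text \<open>The new edge joins two different components, so two classes are replaced by their union
  and all others survive.\<close>

lemma num_components_insert:
  assumes V: "finite V" "a \<in> V" "b \<in> V" and f: "ends f = {a, b}"
    and ab: "(a, b) \<notin> (adj_rel ends T)\<^sup>*"
  shows "num_components V ends T = Suc (num_components V ends (insert f T))"
proof -
  let ?A = "component ends T a" and ?B = "component ends T b"
  let ?C = "component ends T ` V"
  have neq: "?A \<noteq> ?B" using ab component_eq_iff[of ends T a b] by simp
  have "component ends (insert f T) ` V = insert (?A \<union> ?B) (?C - {?A, ?B})"
  proof (intro equalityI subsetI)
    fix X assume "X \<in> component ends (insert f T) ` V"
    then obtain x where x: "x \<in> V" "X = component ends (insert f T) x" by blast
    have "x \<in> component ends T x" by simp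
    then show "X \<in> insert (?A \<union> ?B) (?C - {?A, ?B})"
      using x unfolding component_insert[where ends = ends and f = f and a = a and b = b, OF f] by (auto split: if_splits)
  next
    fix X assume X: "X \<in> insert (?A \<union> ?B) (?C - {?A, ?B})"
    show "X \<in> component ends (insert f T) ` V"
    proof (cases "X = ?A \<union> ?B")
      case True
      have "component ends (insert f T) a = ?A \<union> ?B"
        unfolding component_insert[where ends = ends and f = f and a = a and b = b, OF f] by auto
      then show ?thesis using V True by blast
    next
      case False
      then obtain x where x: "x \<in> V" "X = component ends T x" "X \<noteq> ?A" "X \<noteq> ?B" using X by auto
      have "(a, x) \<notin> (adj_rel ends T)\<^sup>*" "(b, x) \<notin> (adj_rel ends T)\<^sup>*"
        using x component_eq_iff[of ends T _ x] by metis+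
      then have "component ends (insert f T) x = X"
        using x unfolding component_insert[where ends = ends and f = f and a = a and b = b, OF f] by auto
      then show ?thesis using x by blast
    qed
  qed
  \<comment> \<open>The union contains \<open>a\<close>, so an old component equal to it would have
    to be the component of \<open>a\<close>, which has been removed.\<close>
  moreover have "?A \<union> ?B \<notin> ?C - {?A, ?B}"
  proof
    assume "?A \<union> ?B \<in> ?C - {?A, ?B}"
    then obtain x where x: "?A \<union> ?B = component ends T x" "component ends T x \<noteq> ?A" by auto
    then have "(x, a) \<in> (adj_rel ends T)\<^sup>*" by blast
    then show False using x component_eq_iff[of ends T x a] by simp
  qed
  moreover have "card (?C - {?A, ?B}) + 2 = card ?C"
  proof -
    have sub: "{?A, ?B} \<subseteq> ?C" using V by auto
    have "card {?A, ?B} = 2" using neq by simp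
    moreover have "card {?A, ?B} \<le> card ?C" using sub V by (intro card_mono) auto
    ultimately show ?thesis using card_Diff_subset[of "{?A, ?B}" ?C] sub by simp
  qed
  ultimately show ?thesis using V by (simp add: num_components_def)
qed

lemma num_components_empty: "num_components V ends {} = card V"
proof -
  have "adj_rel ends {} = {}" by (simp add: adj_rel_def)
  then have "component ends {} ` V = (\<lambda>x. {x}) ` V" by auto
  then show ?thesis by (simp add: num_components_def card_image)
qed

lemma ends_eq_doubleton:
  assumes "card X \<in> {1, 2::nat}" obtains a b where "X = {a, b}"
  using assms by (auto simp: card_1_singleton_iff card_2_iff)

text \<open>A forest described as an edge set in which every edge is a bridge, so that no cyclic
  lists occur in counting arguments. Loops are excluded, since reachability is reflexive.\<close>

definition acyclic_edges :: "('e \<Rightarrow> 'v set) \<Rightarrow> 'e set \<Rightarrow> bool" where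
  "acyclic_edges ends T \<longleftrightarrow>
     (\<forall>f \<in> T. \<forall>a b. ends f = {a, b} \<longrightarrow> (a, b) \<notin> (adj_rel ends (T - {f}))\<^sup>*)"

text \<open>Without edges there are \<open>card V\<close> components, and each edge lowers their
  number by at most one.\<close>

lemma card_le_num_components:
  assumes "finite T" and V: "finite V" "\<And>f. f \<in> T \<Longrightarrow> ends f \<subseteq> V \<and> card (ends f) \<in> {1, 2}"
  shows "card V \<le> num_components V ends T + card T"
  using assms(1) V(2)
proof induction
  case empty
  then show ?case by (simp add: num_components_empty)
next
  case (insert f T)
  then obtain a b where f: "ends f = {a, b}" by (metis ends_eq_doubleton insertI1)
  have "num_components V ends T \<le> Suc (num_components V ends (insert f T))"
  proof (cases "(a, b) \<in> (adj_rel ends T)\<^sup>*")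
    case True
    then show ?thesis by (simp add: num_components_def adj_rel_insert_redundant[of ends f a b T, OF f])
  next
    case False
    then show ?thesis using num_components_insert[where ends = ends and f = f and a = a and b = b, OF V(1) _ _ f] insert.prems[of f] f by force
  qed
  then show ?case using insert by force
qed

lemma acyclic_edges_mono: "acyclic_edges ends T \<Longrightarrow> S \<subseteq> T \<Longrightarrow> acyclic_edges ends S"
  unfolding acyclic_edges_def
  by (meson Diff_mono adj_rel_rtrancl_mono order_refl subsetD)

text \<open>In a forest every added edge joins two different components, so each lowers the count by
  exactly one.\<close>

lemma card_eq_num_components:
  assumes "finite T" "acyclic_edges ends T"
    and V: "finite V" "\<And>f. f \<in> T \<Longrightarrow> ends f \<subseteq> V \<and> card (ends f) \<in> {1, 2}"
  shows "card V = num_components V ends T + card T"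
  using assms(1,2) V(2)
proof induction
  case empty
  then show ?case by (simp add: num_components_empty)
next
  case (insert f T)
  then obtain a b where f: "ends f = {a, b}" by (metis ends_eq_doubleton insertI1)
  have "(a, b) \<notin> (adj_rel ends T)\<^sup>*"
    using insert.prems(1) f insert.hyps unfolding acyclic_edges_def by (metis Diff_insert_absorb insertI1)
  then have "num_components V ends T = Suc (num_components V ends (insert f T))"
    using num_components_insert[where ends = ends and f = f and a = a and b = b, OF V(1) _ _ f] insert.prems(2)[of f] f by force
  moreover have "acyclic_edges ends T"
    using insert.prems(1) by (rule acyclic_edges_mono) auto
  ultimately show ?case using insert by force
qed

definition edges_connect :: "'v set \<Rightarrow> ('e \<Rightarrow> 'v set) \<Rightarrow> 'e set \<Rightarrow> bool" where
  "edges_connect V ends T \<longleftrightarrow> (\<forall>x \<in> V. \<forall>y \<in> V. (x, y) \<in> (adj_rel ends T)\<^sup>*)"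

lemma num_components_connected:
  assumes "V \<noteq> {}" "edges_connect V ends T"
  shows "num_components V ends T = 1"
proof -
  obtain x where x: "x \<in> V" using assms by blast
  have "component ends T ` V = {component ends T x}"
    using x assms(2) component_eq_iff[of ends T _ x] unfolding edges_connect_def by blast
  then show ?thesis by (simp add: num_components_def)
qed

lemma connected_card_le:
  assumes "finite T" "finite V" "\<And>f. f \<in> T \<Longrightarrow> ends f \<subseteq> V \<and> card (ends f) \<in> {1, 2}"
    and "edges_connect V ends T"
  shows "card V \<le> card T + 1"
proof (cases "V = {}")
  case False
  then show ?thesis
    using card_le_num_components[OF assms(1,2), of ends] assms(3) num_components_connected[OF _ assms(4)]
    by simp
qed simp

text \<open>Among connected edge sets, acyclicity is thereby reduced to a cardinality, which is
  easier to track when a graph is modified.\<close>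

lemma connected_acyclic_iff_card:
  assumes fin: "finite T" "finite V" and nV: "V \<noteq> {}"
    and ends: "\<And>f. f \<in> T \<Longrightarrow> ends f \<subseteq> V \<and> card (ends f) \<in> {1, 2}"
    and conn: "edges_connect V ends T"
  shows "acyclic_edges ends T \<longleftrightarrow> card T + 1 = card V"
proof
  assume "acyclic_edges ends T"
  then show "card T + 1 = card V"
    using card_eq_num_components[OF fin(1) _ fin(2) ends] num_components_connected[OF nV conn] by simp
next
  assume card: "card T + 1 = card V"
  show "acyclic_edges ends T"
  proof (rule ccontr)
    assume "\<not> acyclic_edges ends T"
    then obtain f a b where f: "f \<in> T" "ends f = {a, b}" "(a, b) \<in> (adj_rel ends (T - {f}))\<^sup>*"
      by (auto simp: acyclic_edges_def)
    have "insert f (T - {f}) = T" using f by auto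
    then have "(adj_rel ends T)\<^sup>* = (adj_rel ends (T - {f}))\<^sup>*"
      using adj_rel_insert_redundant[of ends f a b "T - {f}"] f by simp
    then have "edges_connect V ends (T - {f})" using conn by (simp add: edges_connect_def)
    then have "card V \<le> card (T - {f}) + 1"
      using fin ends by (intro connected_card_le[where ends = ends]) auto
    moreover have "card T = Suc (card (T - {f}))" using f fin by (metis card_Suc_Diff1)
    ultimately show False using card by simp
  qed
qed

section \<open>Cycles as lists versus the bridge criterion\<close>

lemma mg_cycle_imp_not_acyclic_edges:
  assumes "mg_cycle G vs es"
  shows "\<not> acyclic_edges (mg_ends G) (mg_edges G)"
proof -
  let ?n = "length es" and ?f = "es ! 0"
  let ?R = "adj_rel (mg_ends G) (mg_edges G - {?f})"
  have c: "es \<noteq> []" "length vs = ?n" "distinct es" "set es \<subseteq> mg_edges G"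
    and e: "\<And>i. i < ?n \<Longrightarrow> mg_ends G (es ! i) = {vs ! i, vs ! (Suc i mod ?n)}"
    using assms by (auto simp: mg_cycle_def)
  have n: "0 < ?n" using c by simp
  \<comment> \<open>Walk round the cycle the long way, starting at the far end of the first edge.
    The \<open>mod\<close> lets a loop, with \<open>?n = 1\<close>, be treated in the same
    way.\<close>
  have "(vs ! (Suc 0 mod ?n), vs ! (Suc i mod ?n)) \<in> ?R\<^sup>*" if "i < ?n" for i
    using that
  proof (induction i)
    case (Suc i)
    have "es ! Suc i \<noteq> ?f" using nth_eq_iff_index_eq[OF c(3), of "Suc i" 0] Suc.prems n by simp
    moreover have "es ! Suc i \<in> mg_edges G" using Suc.prems c(4) nth_mem by blast
    ultimately have "(vs ! Suc i, vs ! (Suc (Suc i) mod ?n)) \<in> ?R"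
      using e[of "Suc i"] Suc.prems by (auto simp: adj_rel_def)
    moreover have "Suc i mod ?n = Suc i" using Suc.prems by simp
    ultimately show ?case using Suc by (auto intro: rtrancl_into_rtrancl)
  qed simp
  from this[of "?n - 1"] have "(vs ! (Suc 0 mod ?n), vs ! 0) \<in> ?R\<^sup>*" using n by simp
  then have "(vs ! 0, vs ! (Suc 0 mod ?n)) \<in> ?R\<^sup>*" by (rule adj_rel_rtrancl_sym)
  moreover have "?f \<in> mg_edges G" using n c(4) nth_mem by blast
  ultimately show ?thesis using e[OF n] unfolding acyclic_edges_def by blast
qed

text \<open>A connection between the ends of \<open>f\<close> that avoids \<open>f\<close> is
  shortened to a path with distinct vertices, and \<open>f\<close> closes it to a cycle. If
  \<open>f\<close> is a loop, the path is empty.\<close>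

lemma not_acyclic_edges_imp_mg_cycle:
  assumes "\<not> acyclic_edges (mg_ends G) (mg_edges G)"
  shows "\<exists>vs es. mg_cycle G vs es"
proof -
  obtain f a b where f: "f \<in> mg_edges G" "mg_ends G f = {a, b}"
    and ab: "(a, b) \<in> (adj_rel (mg_ends G) (mg_edges G - {f}))\<^sup>*"
    using assms by (auto simp: acyclic_edges_def)
  define r where "r = (\<lambda>x y. (x, y) \<in> adj_rel (mg_ends G) (mg_edges G - {f}))"
  have "r\<^sup>*\<^sup>* a b" using ab by (simp add: r_def rtranclp_rtrancl_eq)
  then obtain xs0 where "rtrancl_path r a xs0 b" by (auto simp: rtranclp_eq_rtrancl_path)
  then obtain xs where xs: "rtrancl_path r a xs b" "distinct (a # xs)" by (rule rtrancl_path_distinct)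
  define vs where "vs = a # xs"
  have last: "vs ! length xs = b"
    using xs(1) rtrancl_path_last[OF xs(1)] by (cases "xs = []") (auto simp: vs_def last_conv_nth nth_Cons' elim: rtrancl_path.cases)
  have step: "\<exists>g. g \<in> mg_edges G - {f} \<and> mg_ends G g = {vs ! i, vs ! Suc i}" if "i < length xs" for i
    using rtrancl_path_nth[OF xs(1) that] by (auto simp: r_def adj_rel_def vs_def)
  then obtain g where g: "\<And>i. i < length xs \<Longrightarrow> g i \<in> mg_edges G - {f} \<and> mg_ends G (g i) = {vs ! i, vs ! Suc i}"
    by metis
  define es where "es = map g [0..<length xs] @ [f]"
  have dvs: "distinct vs" "length vs = Suc (length xs)" using xs by (auto simp: vs_def)
  \<comment> \<open>Different steps of a path with distinct vertices have different endpoint sets,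
    so the chosen edges are different.\<close>
  have "inj_on g {0..<length xs}"
  proof (rule inj_onI)
    fix i j assume ij: "i \<in> {0..<length xs}" "j \<in> {0..<length xs}" "g i = g j"
    then have "{vs ! i, vs ! Suc i} = {vs ! j, vs ! Suc j}" using g by (metis atLeastLessThan_iff)
    then show "i = j" using ij dvs by (auto simp: doubleton_eq_iff nth_eq_iff_index_eq)
  qed
  then have des: "distinct es" using g by (fastforce simp: es_def distinct_map)
  have "mg_cycle G vs es"
    unfolding mg_cycle_def
  proof (intro conjI allI impI)
    show "es \<noteq> []" "length vs = length es" "distinct vs" "distinct es"
      using dvs des by (simp_all add: es_def)
    show "set es \<subseteq> mg_edges G" using g f by (auto simp: es_def)
    fix i assume i: "i < length es"
    show "mg_ends G (es ! i) = {vs ! i, vs ! (Suc i mod length es)}"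
    proof (cases "i = length xs")
      case True
      then have "es ! i = f" "Suc i mod length es = 0" by (simp_all add: es_def nth_append)
      moreover have "vs ! 0 = a" by (simp add: vs_def)
      ultimately show ?thesis using f True last by (simp add: insert_commute)
    next
      case False
      then have "i < length xs" using i by (simp add: es_def)
      then show ?thesis using g[of i] by (simp add: es_def nth_append)
    qed
  qed
  then show ?thesis by blast
qed

text \<open>From here on a spanning tree is a connecting edge set of the right size. A vertex must
  exist because \<open>mg_connected\<close> asks for one while \<open>edges_connect\<close> does
  not.\<close>

lemma spanning_trees_eq:
  assumes "wf_multigraph G" "mg_verts G \<noteq> {}"
  shows "spanning_trees G =
    {T. T \<subseteq> mg_edges G \<and> edges_connect (mg_verts G) (mg_ends G) T \<and> card T + 1 = card (mg_verts G)}"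
proof -
  have "mg_tree (G\<lparr>mg_edges := T\<rparr>) \<longleftrightarrow>
      edges_connect (mg_verts G) (mg_ends G) T \<and> card T + 1 = card (mg_verts G)"
    if T: "T \<subseteq> mg_edges G" for T
  proof -
    let ?H = "G\<lparr>mg_edges := T\<rparr>"
    have conn: "mg_connected ?H \<longleftrightarrow> edges_connect (mg_verts G) (mg_ends G) T"
      using assms(2) by (simp add: mg_connected_def edges_connect_def mg_adj_eq_adj_rel)
    have cyc: "(\<nexists>vs es. mg_cycle ?H vs es) \<longleftrightarrow> acyclic_edges (mg_ends G) T"
      using mg_cycle_imp_not_acyclic_edges[of ?H] not_acyclic_edges_imp_mg_cycle[of ?H] by auto
    have "finite T" using assms T by (auto simp: wf_multigraph_def intro: finite_subset)
    then have "edges_connect (mg_verts G) (mg_ends G) T \<Longrightarrow>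
        acyclic_edges (mg_ends G) T \<longleftrightarrow> card T + 1 = card (mg_verts G)"
      using assms T by (intro connected_acyclic_iff_card) (auto simp: wf_multigraph_def)
    then show ?thesis unfolding mg_tree_def conn cyc by blast
  qed
  then show ?thesis unfolding spanning_trees_def by blast
qed

section \<open>Adding a vertex of degree two\<close>

text \<open>Simple graphs are represented by sets of two-element vertex sets with \<open>id\<close>
  as endpoint map, which rules out parallel edges and loops by itself.\<close>

definition edges_on :: "'v set \<Rightarrow> 'v set set \<Rightarrow> bool" where
  "edges_on V E \<longleftrightarrow> finite V \<and> (\<forall>f \<in> E. f \<subseteq> V \<and> card f = 2)"

definition trees :: "'v set \<Rightarrow> 'v set set \<Rightarrow> 'v set set set" where
  "trees V E = {T. T \<subseteq> E \<and> edges_connect V id T \<and> card T + 1 = card V}"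

lemma edges_on_finite: "edges_on V E \<Longrightarrow> finite E"
  unfolding edges_on_def by (rule finite_subset[of _ "Pow V"]) auto

lemma edges_on_subset: "edges_on V E \<Longrightarrow> T \<subseteq> E \<Longrightarrow> edges_on V T"
  unfolding edges_on_def by blast

lemma finite_trees: "edges_on V E \<Longrightarrow> finite (trees V E)"
  by (rule finite_subset[of _ "Pow E"]) (auto simp: trees_def edges_on_finite)

lemma edges_connect_card_le:
  "edges_on V T \<Longrightarrow> edges_connect V id T \<Longrightarrow> card V \<le> card T + 1"
  using edges_on_finite[of V T] by (intro connected_card_le[where ends = id]) (auto simp: edges_on_def)

lemma not_edges_connect_isolated:
  assumes "z \<notin> V" "V \<noteq> {}" "edges_on V T"
  shows "\<not> edges_connect (insert z V) id T"
proof
  assume c: "edges_connect (insert z V) id T"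
  obtain x where x: "x \<in> V" using assms by blast
  then have "(z, x) \<in> (adj_rel id T)\<^sup>*" "z \<noteq> x" using c assms by (auto simp: edges_connect_def)
  then obtain w where "(z, w) \<in> adj_rel id T" by (meson converse_rtranclE)
  then show False using assms by (auto simp: adj_rel_def edges_on_def)
qed

lemma edges_connect_insert_leaf:
  assumes z: "z \<notin> V" and x: "x \<in> V" and T: "edges_on V T"
  shows "edges_connect (insert z V) id (insert {x, z} T) \<longleftrightarrow> edges_connect V id T"
proof
  assume c: "edges_connect (insert z V) id (insert {x, z} T)"
  \<comment> \<open>Retracting the leaf \<open>z\<close> onto its neighbour turns walks of the
    larger graph into walks of the smaller one.\<close>
  define h where "h v = (if v = z then x else v)" for v
  have "(h u, h v) \<in> (adj_rel id T)\<^sup>*" if "(u, v) \<in> adj_rel id (insert {x, z} T)" for u v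
  proof -
    from that consider "{u, v} = {x, z}" | "{u, v} \<in> T" by (auto simp: adj_rel_def)
    then show ?thesis
    proof cases
      case 1
      then have "h u = h v" by (auto simp: h_def doubleton_eq_iff)
      then show ?thesis by simp
    next
      case 2
      then have "u \<noteq> z" "v \<noteq> z" using z T by (auto simp: edges_on_def)
      then show ?thesis using 2 by (auto simp: adj_rel_def h_def)
    qed
  qed
  then have "(h u, h v) \<in> (adj_rel id T)\<^sup>*" if "(u, v) \<in> (adj_rel id (insert {x, z} T))\<^sup>*" for u v
    using that by (rule rtrancl_map_rtrancl[rotated])
  moreover have "h v = v" if "v \<in> V" for v using that z by (auto simp: h_def)
  ultimately show "edges_connect V id T"
    using c unfolding edges_connect_def by (metis insertCI)
next
  assume c: "edges_connect V id T"
  let ?R = "(adj_rel id (insert {x, z} T))\<^sup>*"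
  have "(x, z) \<in> ?R" by (auto simp: adj_rel_def)
  then have xz: "(x, z) \<in> ?R" "(z, x) \<in> ?R" by (auto intro: adj_rel_rtrancl_sym)
  have V: "(u, v) \<in> ?R" if "u \<in> V" "v \<in> V" for u v
    using c that adj_rel_rtrancl_mono[of T "insert {x, z} T" u v id] by (auto simp: edges_connect_def)
  have "(u, x) \<in> ?R \<and> (x, u) \<in> ?R" if "u \<in> insert z V" for u
    using that xz V x by auto
  then show "edges_connect (insert z V) id (insert {x, z} T)"
    unfolding edges_connect_def by (meson rtrancl_trans)
qed

text \<open>For connectivity the path from \<open>x\<close> over \<open>z\<close> to
  \<open>y\<close> does the same as the edge \<open>{x, y}\<close>. In one direction
  \<open>z\<close> is merged into \<open>x\<close>, in the other the edge is replaced by the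
  path.\<close>

lemma edges_connect_subdivide:
  assumes z: "z \<notin> V" and xy: "x \<in> V" "y \<in> V" and T: "edges_on V T"
  shows "edges_connect (insert z V) id (insert {x, z} (insert {y, z} T)) \<longleftrightarrow>
    edges_connect V id (insert {x, y} T)"
proof
  assume c: "edges_connect (insert z V) id (insert {x, z} (insert {y, z} T))"
  let ?S = "(adj_rel id (insert {x, y} T))\<^sup>*"
  define h where "h v = (if v = z then x else v)" for v
  have xy': "(x, y) \<in> ?S" "(y, x) \<in> ?S" by (auto simp: adj_rel_def insert_commute)
  have "(h u, h v) \<in> ?S" if "(u, v) \<in> adj_rel id (insert {x, z} (insert {y, z} T))" for u v
  proof -
    from that consider "{u, v} = {x, z}" | "{u, v} = {y, z}" | "{u, v} \<in> T" by (auto simp: adj_rel_def)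
    then show ?thesis
    proof cases
      case 1
      then have "h u = h v" by (auto simp: h_def doubleton_eq_iff)
      then show ?thesis by simp
    next
      case 2
      then have "(h u = x \<and> h v = y) \<or> (h u = y \<and> h v = x)"
        using z xy by (auto simp: h_def doubleton_eq_iff)
      then show ?thesis using xy' by auto
    next
      case 3
      then have "u \<noteq> z" "v \<noteq> z" using z T by (auto simp: edges_on_def)
      then show ?thesis using 3 by (auto simp: adj_rel_def h_def)
    qed
  qed
  then have "(h u, h v) \<in> ?S" if "(u, v) \<in> (adj_rel id (insert {x, z} (insert {y, z} T)))\<^sup>*" for u v
    using that by (rule rtrancl_map_rtrancl[rotated])
  moreover have "h v = v" if "v \<in> V" for v using that z by (auto simp: h_def)
  ultimately show "edges_connect V id (insert {x, y} T)"
    using c unfolding edges_connect_def by (metis insertCI)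
next
  assume c: "edges_connect V id (insert {x, y} T)"
  let ?R = "(adj_rel id (insert {x, z} (insert {y, z} T)))\<^sup>*"
  have "(x, z) \<in> ?R" "(y, z) \<in> ?R" by (auto simp: adj_rel_def)
  then have xz: "(x, z) \<in> ?R" "(z, x) \<in> ?R" "(y, z) \<in> ?R" "(z, y) \<in> ?R"
    by (auto intro: adj_rel_rtrancl_sym)
  have "(u, v) \<in> ?R" if "(u, v) \<in> adj_rel id (insert {x, y} T)" for u v
  proof -
    from that consider "{u, v} = {x, y}" | "{u, v} \<in> T" by (auto simp: adj_rel_def)
    then show ?thesis
    proof cases
      case 1
      then show ?thesis using xz by (auto simp: doubleton_eq_iff intro: rtrancl_trans)
    qed (auto simp: adj_rel_def)
  qed
  then have "(u, v) \<in> ?R" if "(u, v) \<in> (adj_rel id (insert {x, y} T))\<^sup>*" for u v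
    using that rtrancl_map_rtrancl[of u v _ "\<lambda>v. v"] by auto
  then have V: "(u, v) \<in> ?R" if "u \<in> V" "v \<in> V" for u v
    using c that by (auto simp: edges_connect_def)
  have "(u, x) \<in> ?R \<and> (x, u) \<in> ?R" if "u \<in> insert z V" for u
    using that xz V xy by auto
  then show "edges_connect (insert z V) id (insert {x, z} (insert {y, z} T))"
    unfolding edges_connect_def by (meson rtrancl_trans)
qed

text \<open>The edge \<open>{x, y}\<close> stays when it belongs to \<open>E\<close>; subdivision is
  obtained by removing it afterwards.\<close>

definition add_vertex :: "'v \<Rightarrow> 'v \<Rightarrow> 'v \<Rightarrow> 'v set set \<Rightarrow> 'v set set" where
  "add_vertex x y z E = insert {x, z} (insert {y, z} E)"

locale ear =
  fixes V :: "'v set" and E :: "'v set set" and x y z :: 'v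
  assumes E: "edges_on V E" and xy: "x \<noteq> y" "{x, y} \<in> E" and z: "z \<notin> V"
begin

lemma xyV: "x \<in> V" "y \<in> V"
  using E xy by (auto simp: edges_on_def)

lemma fresh: "z \<noteq> x" "z \<noteq> y" "{x, z} \<noteq> {y, z}" "f \<in> E \<Longrightarrow> z \<notin> f" "{x, z} \<notin> E" "{y, z} \<notin> E"
  "{x, y} \<noteq> {x, z}" "{x, y} \<noteq> {y, z}"
  using xyV z E xy by (auto simp: edges_on_def doubleton_eq_iff)

lemma edges_on_add_vertex: "edges_on (insert z V) (add_vertex x y z E)"
  using E xyV fresh by (auto simp: edges_on_def add_vertex_def)

abbreviation (input) through :: "'v set set \<Rightarrow> 'v set set" where
  "through T \<equiv> insert {x, z} (insert {y, z} (T - {{x, y}}))"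

text \<open>A spanning tree must reach \<open>z\<close>. If it uses one new edge, \<open>z\<close>
  is a leaf and the rest is an old tree; if it uses both, they stand for the edge
  \<open>{x, y}\<close> of an old tree.\<close>

lemma trees_add_vertex:
  "trees (insert z V) (add_vertex x y z E) =
    insert {x, z} ` trees V E \<union> insert {y, z} ` trees V E \<union>
    through ` {T \<in> trees V E. {x, y} \<in> T}" (is "?L = ?A \<union> ?B \<union> ?C")
proof (intro equalityI subsetI)
  fix T assume "T \<in> ?L"
  then have T: "T \<subseteq> insert {x, z} (insert {y, z} E)" "edges_connect (insert z V) id T"
    "card T = card V"
    using E z by (auto simp: trees_def add_vertex_def edges_on_def)
  define S where "S = T - {{x, z}, {y, z}}"
  have S: "S \<subseteq> E" "{x, z} \<notin> S" "{y, z} \<notin> S" using T by (auto simp: S_def)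
  have Son: "edges_on V S" using E S(1) by (rule edges_on_subset)
  have fin: "finite S" using Son by (rule edges_on_finite)
  consider "T = S" | "T = insert {x, z} S" | "T = insert {y, z} S"
    | "T = insert {x, z} (insert {y, z} S)"
    by (auto simp: S_def)
  then show "T \<in> ?A \<union> ?B \<union> ?C"
  proof cases
    case 1
    then show ?thesis using not_edges_connect_isolated[OF z _ Son] T xyV by auto
  next
    case 2
    then have "S \<in> trees V E"
      using T S fin edges_connect_insert_leaf[OF z xyV(1) Son] by (simp add: trees_def)
    then show ?thesis using 2 by blast
  next
    case 3
    then have "S \<in> trees V E"
      using T S fin edges_connect_insert_leaf[OF z xyV(2) Son] by (simp add: trees_def)
    then show ?thesis using 3 by blast
  next
    case 4
    have c: "edges_connect V id (insert {x, y} S)"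
      using edges_connect_subdivide[OF z xyV Son] T 4 by simp
    have card: "card S + 2 = card V" using T 4 S fin fresh by simp
    \<comment> \<open>Otherwise \<open>S\<close> alone would connect \<open>V\<close> with only
      \<open>card V - 2\<close> edges.\<close>
    have "{x, y} \<notin> S"
    proof
      assume "{x, y} \<in> S"
      then have "edges_connect V id S" using c by (simp add: insert_absorb)
      then show False using edges_connect_card_le[OF Son] card by simp
    qed
    then have "insert {x, y} S \<in> trees V E" "S = insert {x, y} S - {{x, y}}"
      using c card fin S xy by (auto simp: trees_def)
    then show ?thesis using 4 by blast
  qed
next
  have cardV: "card (insert z V) = Suc (card V)" using z E by (simp add: edges_on_def)
  fix T assume "T \<in> ?A \<union> ?B \<union> ?C"
  then consider (a) S where "S \<in> trees V E" "T = insert {x, z} S"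
    | (b) S where "S \<in> trees V E" "T = insert {y, z} S"
    | (c) S where "S \<in> trees V E" "{x, y} \<in> S" "T = through S"
    by blast
  then show "T \<in> ?L"
  proof cases
    case a
    then have S: "S \<subseteq> E" "edges_on V S" "{x, z} \<notin> S"
      using E fresh edges_on_subset by (auto simp: trees_def)
    then show ?thesis using a edges_connect_insert_leaf[OF z xyV(1) S(2)] edges_on_finite[OF S(2)] cardV
      by (auto simp: trees_def add_vertex_def)
  next
    case b
    then have S: "S \<subseteq> E" "edges_on V S" "{y, z} \<notin> S"
      using E fresh edges_on_subset by (auto simp: trees_def)
    then show ?thesis using b edges_connect_insert_leaf[OF z xyV(2) S(2)] edges_on_finite[OF S(2)] cardV
      by (auto simp: trees_def add_vertex_def)
  next
    case c
    let ?S = "S - {{x, y}}"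
    have S: "S \<subseteq> E" "edges_on V ?S" "{x, z} \<notin> ?S" "{y, z} \<notin> ?S"
      using E fresh c edges_on_subset[of V E ?S] by (auto simp: trees_def)
    have "insert {x, y} ?S = S" using c by auto
    then have "edges_connect (insert z V) id T"
      using c edges_connect_subdivide[OF z xyV S(2)] by (simp add: trees_def)
    moreover have "card T = card ?S + 2"
      using c(3) S fresh edges_on_finite[OF S(2)] by simp
    moreover have "card S = card ?S + 1"
      using c(2) edges_on_finite[OF S(2)] by (metis Suc_eq_plus1 card_Suc_Diff1 finite_Diff_insert finite.emptyI Diff_empty)
    moreover have "card S + 1 = card V" using c(1) by (simp add: trees_def)
    moreover have "T \<subseteq> add_vertex x y z E" unfolding add_vertex_def c(3) using S(1) by blast
    ultimately show ?thesis using cardV by (simp add: trees_def)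
  qed
qed

lemma trees_fresh: "T \<in> trees V E \<Longrightarrow> {x, z} \<notin> T \<and> {y, z} \<notin> T"
  using fresh by (auto simp: trees_def)

end

section \<open>Effect of the new vertex on the vector of an edge\<close>

text \<open>Here \<open>W\<close> and \<open>U\<close> stand for the old trees with and without
  \<open>e\<close>, and \<open>a\<close>, \<open>b\<close> for the new edges. The new trees fall
  into five classes told apart by which of \<open>a\<close>, \<open>b\<close>, \<open>e\<close> they
  contain. The three pairs of counts give the operations \<open>P\<close>, \<open>D\<close> and
  \<open>S\<close>, in this order.\<close>

lemma card_partition_insert:
  fixes a b e :: 'a
  assumes fin: "finite W" "finite U" and dist: "a \<noteq> b" "a \<noteq> e" "b \<noteq> e"
    and W: "\<And>T. T \<in> W \<Longrightarrow> a \<notin> T \<and> b \<notin> T \<and> e \<in> T"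
    and U: "\<And>T. T \<in> U \<Longrightarrow> a \<notin> T \<and> b \<notin> T \<and> e \<notin> T"
    and F: "F = insert a ` (W \<union> U) \<union> insert b ` (W \<union> U) \<union> (\<lambda>T. insert a (insert b (T - {e}))) ` W"
  shows "card {T \<in> F. a \<in> T} = 2 * card W + card U"
    and "card {T \<in> F. a \<notin> T} = card W + card U"
    and "card {T \<in> F. e \<in> T} = 2 * card W"
    and "card {T \<in> F. e \<notin> T} = card W + 2 * card U"
    and "card {T \<in> F. e \<notin> T \<and> a \<in> T} = card W + card U"
    and "card {T \<in> F. e \<notin> T \<and> a \<notin> T} = card U"
proof -
  let ?g = "\<lambda>T. insert a (insert b (T - {e}))"
  define aW aU bW bU gW where defs: "aW = insert a ` W" "aU = insert a ` U"
    "bW = insert b ` W" "bU = insert b ` U" "gW = ?g ` W"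
  have ins: "card (insert f ` A) = card A" if "\<And>T. T \<in> A \<Longrightarrow> f \<notin> T" for f and A :: "'a set set"
    using that by (intro card_image inj_onI) (metis insert_ident)
  have "inj_on ?g W"
  proof (rule inj_on_inverseI)
    fix T assume "T \<in> W"
    \<comment> \<open>A left inverse of \<open>?g\<close> on \<open>W\<close>: put \<open>e\<close>
      back in place of the two new edges.\<close>
    then show "insert e (?g T - {a, b}) = T" using W[of T] dist by auto
  qed
  then have "card gW = card W" unfolding defs by (rule card_image)
  moreover have "card aW = card W" "card aU = card U" "card bW = card W" "card bU = card U"
    unfolding defs using W U by (auto intro!: ins)
  ultimately have c: "card aW = card W" "card aU = card U" "card bW = card W" "card bU = card U"
    "card gW = card W" by simp_all
  have f: "finite aW" "finite aU" "finite bW" "finite bU" "finite gW"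
    using fin by (simp_all add: defs)
  have mem: "T \<in> aW \<Longrightarrow> a \<in> T \<and> b \<notin> T \<and> e \<in> T" "T \<in> aU \<Longrightarrow> a \<in> T \<and> b \<notin> T \<and> e \<notin> T"
    "T \<in> bW \<Longrightarrow> a \<notin> T \<and> b \<in> T \<and> e \<in> T" "T \<in> bU \<Longrightarrow> a \<notin> T \<and> b \<in> T \<and> e \<notin> T"
    "T \<in> gW \<Longrightarrow> a \<in> T \<and> b \<in> T \<and> e \<notin> T" for T
    unfolding defs using W U dist by auto
  have F': "F = aW \<union> aU \<union> bW \<union> bU \<union> gW" unfolding F defs image_Un by (simp add: ac_simps)
  have d: "(aW \<union> aU) \<inter> gW = {}" "aW \<inter> aU = {}" "bW \<inter> bU = {}" "aW \<inter> bW = {}"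
    "(gW \<union> aU) \<inter> bU = {}" "gW \<inter> aU = {}"
    by (auto dest: mem)
  note un = card_Un_disjoint c f d
  have "{T \<in> F. a \<in> T} = (aW \<union> aU) \<union> gW" unfolding F' by (auto dest: mem)
  then show "card {T \<in> F. a \<in> T} = 2 * card W + card U" by (simp add: un)
  have "{T \<in> F. a \<notin> T} = bW \<union> bU" unfolding F' by (auto dest: mem)
  then show "card {T \<in> F. a \<notin> T} = card W + card U" by (simp add: un)
  have "{T \<in> F. e \<in> T} = aW \<union> bW" unfolding F' by (auto dest: mem)
  then show "card {T \<in> F. e \<in> T} = 2 * card W" by (simp add: un)
  have "{T \<in> F. e \<notin> T} = (gW \<union> aU) \<union> bU" unfolding F' by (auto dest: mem)
  then show "card {T \<in> F. e \<notin> T} = card W + 2 * card U" by (simp add: un)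
  have "{T \<in> F. e \<notin> T \<and> a \<in> T} = gW \<union> aU" unfolding F' by (auto dest: mem)
  then show "card {T \<in> F. e \<notin> T \<and> a \<in> T} = card W + card U" by (simp add: un)
  have "{T \<in> F. e \<notin> T \<and> a \<notin> T} = bU" unfolding F' by (auto dest: mem)
  then show "card {T \<in> F. e \<notin> T \<and> a \<notin> T} = card U" by (simp add: un)
qed

text \<open>The pair \<open>(t, u)\<close> in terms of trees of the graph itself; contraction enters
  only when feasibility is concluded.\<close>

definition edge_vector :: "'v set \<Rightarrow> 'v set set \<Rightarrow> 'v set \<Rightarrow> int \<times> int" where
  "edge_vector V E e =
     (int (card {T \<in> trees V E. e \<in> T}), int (card {T \<in> trees V E. e \<notin> T}))"

context ear
begin

lemma edge_vectors_add_vertex: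
  assumes tu: "edge_vector V E {x, y} = (t, u)"
  shows "edge_vector (insert z V) (add_vertex x y z E) {x, z} = (2 * t + u, t + u)"
    and "edge_vector (insert z V) (add_vertex x y z E) {x, y} = (2 * t, t + 2 * u)"
    and "edge_vector (insert z V) (add_vertex x y z E - {{x, y}}) {x, z} = (t + u, u)"
proof -
  let ?W = "{T \<in> trees V E. {x, y} \<in> T}" and ?U = "{T \<in> trees V E. {x, y} \<notin> T}"
  let ?F = "trees (insert z V) (add_vertex x y z E)"
  have "trees V E = ?W \<union> ?U" by auto
  then have F: "?F = insert {x, z} ` (?W \<union> ?U) \<union> insert {y, z} ` (?W \<union> ?U) \<union> through ` ?W"
    using trees_add_vertex by simp
  have fin: "finite ?W" "finite ?U" using finite_trees[OF E] by auto
  have neq: "{x, z} \<noteq> {y, z}" "{x, z} \<noteq> {x, y}" "{y, z} \<noteq> {x, y}" using fresh by metis+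
  have W: "{x, z} \<notin> T \<and> {y, z} \<notin> T \<and> {x, y} \<in> T" if "T \<in> ?W" for T using that trees_fresh by simp
  have U: "{x, z} \<notin> T \<and> {y, z} \<notin> T \<and> {x, y} \<notin> T" if "T \<in> ?U" for T using that trees_fresh by simp
  note cards = card_partition_insert[OF fin neq W U F]
  \<comment> \<open>Deleting \<open>{x, y}\<close> keeps the vertex set, so the trees that remain
    are those avoiding this edge.\<close>
  have del: "trees (insert z V) (add_vertex x y z E - {{x, y}}) = {T \<in> ?F. {x, y} \<notin> T}"
    unfolding trees_def by blast
  have tu': "t = int (card ?W)" "u = int (card ?U)" using tu by (simp_all add: edge_vector_def)
  show "edge_vector (insert z V) (add_vertex x y z E) {x, z} = (2 * t + u, t + u)"
    "edge_vector (insert z V) (add_vertex x y z E) {x, y} = (2 * t, t + 2 * u)"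
    "edge_vector (insert z V) (add_vertex x y z E - {{x, y}}) {x, z} = (t + u, u)"
    unfolding edge_vector_def del mem_Collect_eq conj_assoc tu' using cards by simp_all
qed

end

section \<open>Straight-line drawings\<close>

text \<open>For an edge with two ends the convex hull is the segment between their images. Written
  with hulls, the conditions pass through linear maps and are easily confined to a convex
  region.\<close>

definition straight_drawing :: "'v set \<Rightarrow> 'v set set \<Rightarrow> ('v \<Rightarrow> real \<times> real) \<Rightarrow> bool" where
  "straight_drawing V E p \<longleftrightarrow> inj_on p V \<and>
     (\<forall>f \<in> E. \<forall>v \<in> V. p v \<in> convex hull (p ` f) \<longrightarrow> v \<in> f) \<and>
     (\<forall>f \<in> E. \<forall>g \<in> E. f \<noteq> g \<longrightarrow> convex hull (p ` f) \<inter> convex hull (p ` g) \<subseteq> p ` f \<inter> p ` g)"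

lemma straight_drawing_subset: "straight_drawing V E p \<Longrightarrow> E' \<subseteq> E \<Longrightarrow> straight_drawing V E' p"
  unfolding straight_drawing_def by (meson subsetD)

lemma straight_drawing_linear_image:
  assumes "straight_drawing V E p" "linear L" "inj L"
  shows "straight_drawing V E (\<lambda>v. L (p v))"
proof -
  have im: "(\<lambda>v. L (p v)) ` f = L ` p ` f" for f by (simp add: image_image)
  have "inj_on (\<lambda>v. L (p v)) V"
    using assms unfolding straight_drawing_def inj_on_def by (meson UNIV_I)
  moreover have "v \<in> f" if "f \<in> E" "v \<in> V" "L (p v) \<in> L ` (convex hull (p ` f))" for f v
    using that assms unfolding straight_drawing_def by (simp add: inj_image_mem_iff)
  moreover have "L ` (convex hull (p ` f)) \<inter> L ` (convex hull (p ` g)) \<subseteq> L ` p ` f \<inter> L ` p ` g"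
    if "f \<in> E" "g \<in> E" "f \<noteq> g" for f g
    using that assms unfolding straight_drawing_def image_Int[OF assms(3), symmetric]
    by (intro image_mono) auto
  ultimately show ?thesis unfolding straight_drawing_def im convex_hull_linear_image[OF assms(2), symmetric]
    by blast
qed

text \<open>The old drawing lies inside the convex set \<open>K\<close>, which each new segment
  leaves at once, so new segments meet old edges at most in \<open>p x\<close> or
  \<open>p y\<close>.\<close>

lemma (in ear) straight_drawing_add_vertex:
  assumes p: "straight_drawing V E p" and K: "convex K" "p ` V \<subseteq> K" "q \<notin> K"
    and xq: "closed_segment (p x) q \<inter> K \<subseteq> {p x}" and yq: "closed_segment (p y) q \<inter> K \<subseteq> {p y}"
    and xyq: "closed_segment (p x) q \<inter> closed_segment (p y) q \<subseteq> {q}"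
  shows "straight_drawing (insert z V) (add_vertex x y z E) (p(z := q))"
proof -
  let ?p = "p(z := q)"
  have im: "?p ` f = p ` f" if "f \<in> E" for f using fresh(4)[OF that] by auto
  have hK: "convex hull (p ` f) \<subseteq> K" if "f \<in> E" for f
    using that E K by (intro hull_minimal) (auto simp: edges_on_def)
  have seg: "convex hull (?p ` {x, z}) = closed_segment (p x) q"
    "convex hull (?p ` {y, z}) = closed_segment (p y) q"
    using fresh by (auto simp: segment_convex_hull)
  have new: "?p ` {x, z} = {p x, q}" "?p ` {y, z} = {p y, q}" using fresh by auto
  have inj: "inj_on p V" and old1: "\<And>f v. f \<in> E \<Longrightarrow> v \<in> V \<Longrightarrow> p v \<in> convex hull (p ` f) \<Longrightarrow> v \<in> f"
    and old2: "\<And>f g. f \<in> E \<Longrightarrow> g \<in> E \<Longrightarrow> f \<noteq> g \<Longrightarrow> convex hull (p ` f) \<inter> convex hull (p ` g) \<subseteq> p ` f \<inter> p ` g"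
    using p unfolding straight_drawing_def by blast+
  have pV: "p v \<in> K" if "v \<in> V" for v using K that by auto
  have "inj_on ?p (insert z V)"
    using inj z K pV by (auto simp: inj_on_def)
  moreover have "v \<in> f" if f: "f \<in> add_vertex x y z E" and v: "v \<in> insert z V"
    and h: "?p v \<in> convex hull (?p ` f)" for f v
  proof -
    from f consider "f = {x, z}" | "f = {y, z}" | "f \<in> E" by (auto simp: add_vertex_def)
    then show ?thesis
    proof cases
      case 1
      show ?thesis
      proof (cases "v = z")
        case False
        then have "v \<in> V" "p v \<in> closed_segment (p x) q" using v h 1 seg by auto
        then have "p v = p x" using xq pV by blast
        then show ?thesis using inj \<open>v \<in> V\<close> xyV 1 by (auto simp: inj_on_def)
      qed (use 1 in simp)
    next
      case 2
      show ?thesis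
      proof (cases "v = z")
        case False
        then have "v \<in> V" "p v \<in> closed_segment (p y) q" using v h 2 seg by auto
        then have "p v = p y" using yq pV by blast
        then show ?thesis using inj \<open>v \<in> V\<close> xyV 2 by (auto simp: inj_on_def)
      qed (use 2 in simp)
    next
      case 3
      then have h': "?p v \<in> convex hull (p ` f)" using h im by simp
      then have "v \<noteq> z" using hK[OF 3] K by auto
      then show ?thesis using old1[OF 3] v h' by auto
    qed
  qed
  moreover have "convex hull (?p ` f) \<inter> convex hull (?p ` g) \<subseteq> ?p ` f \<inter> ?p ` g"
    if fg: "f \<in> add_vertex x y z E" "g \<in> add_vertex x y z E" "f \<noteq> g" for f g
  proof -
    \<comment> \<open>The only possible meeting point is \<open>p x\<close>; a drawn edge that
      contains this vertex has it as an end.\<close>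
    have xE: "closed_segment (p x) q \<inter> convex hull (p ` f) \<subseteq> {p x} \<inter> p ` f" if "f \<in> E" for f
      using xq hK[OF that] old1[OF that xyV(1)] by blast
    have yE: "closed_segment (p y) q \<inter> convex hull (p ` f) \<subseteq> {p y} \<inter> p ` f" if "f \<in> E" for f
      using yq hK[OF that] old1[OF that xyV(2)] by blast
    have "f = {x, z} \<or> f = {y, z} \<or> f \<in> E" "g = {x, z} \<or> g = {y, z} \<or> g \<in> E"
      using fg by (auto simp: add_vertex_def)
    then show ?thesis
    proof (elim disjE)
      assume "f = {x, z}" "g = {x, z}" then show ?thesis using fg(3) by simp
    next
      assume "f = {y, z}" "g = {y, z}" then show ?thesis using fg(3) by simp
    next
      assume a: "f = {x, z}" "g = {y, z}"
      show ?thesis unfolding a new segment_convex_hull[symmetric] using xyq by blast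
    next
      assume a: "f = {y, z}" "g = {x, z}"
      show ?thesis unfolding a new segment_convex_hull[symmetric] using xyq by blast
    next
      assume a: "f = {x, z}" "g \<in> E"
      show ?thesis unfolding a(1) new segment_convex_hull[symmetric] im[OF a(2)] using xE[OF a(2)] by blast
    next
      assume a: "f = {y, z}" "g \<in> E"
      show ?thesis unfolding a(1) new segment_convex_hull[symmetric] im[OF a(2)] using yE[OF a(2)] by blast
    next
      assume a: "g = {x, z}" "f \<in> E"
      show ?thesis unfolding a(1) new segment_convex_hull[symmetric] im[OF a(2)] using xE[OF a(2)] by blast
    next
      assume a: "g = {y, z}" "f \<in> E"
      show ?thesis unfolding a(1) new segment_convex_hull[symmetric] im[OF a(2)] using yE[OF a(2)] by blast
    next
      assume a: "f \<in> E" "g \<in> E"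
      show ?thesis unfolding im[OF a(1)] im[OF a(2)] using old2[OF a fg(3)] .
    qed
  qed
  ultimately show ?thesis unfolding straight_drawing_def by blast
qed

text \<open>With the distinguished edge on the outer boundary, a new vertex can be put below it (after a
  shear, so that the next distinguished edge is again on the boundary) or far above everything else.\<close>

definition based_drawing :: "'v set \<Rightarrow> 'v set set \<Rightarrow> 'v \<Rightarrow> 'v \<Rightarrow> ('v \<Rightarrow> real \<times> real) \<Rightarrow> bool" where
  "based_drawing V E x y p \<longleftrightarrow> straight_drawing V E p \<and> p x = (0, 0) \<and> p y = (1, 0) \<and>
     (\<forall>v \<in> V - {x, y}. 0 < fst (p v) \<and> fst (p v) < 1 \<and> 0 < snd (p v))"

context ear
begin

lemma based_drawing_swap:
  assumes "based_drawing V E x y p"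
  shows "\<exists>p'. based_drawing (insert z V) (add_vertex x y z E) x z p'"
proof -
  \<comment> \<open>This map fixes the position of \<open>x\<close> and moves \<open>y\<close> from
    \<open>(1, 0)\<close> to \<open>(1/2, 1)\<close>, which frees \<open>(1, 0)\<close> for
    \<open>z\<close>. The old vertices other than \<open>x\<close> end up strictly above the new
    base.\<close>
  define L :: "real \<times> real \<Rightarrow> real \<times> real" where "L w = (fst w / 2, fst w + snd w)" for w
  have "linear L" by (auto simp: L_def linear_iff field_simps)
  moreover have "inj L" by (auto simp: L_def inj_def prod_eq_iff)
  ultimately have d: "straight_drawing V E (\<lambda>v. L (p v))"
    using assms straight_drawing_linear_image[of V E p L] by (simp add: based_drawing_def)
  have pv: "0 \<le> fst (p v) \<and> fst (p v) \<le> 1 \<and> 0 \<le> snd (p v)" if "v \<in> V" for v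
    using assms that unfolding based_drawing_def by (cases "v = x \<or> v = y") (auto intro: less_imp_le)
  have px: "L (p x) = (0, 0)" "L (p y) = (1/2, 1)" using assms by (auto simp: based_drawing_def L_def)
  \<comment> \<open>\<open>K\<close> is bounded by the line through the images of \<open>x\<close>
    and \<open>y\<close> and by the vertical line through the image of \<open>y\<close>; the point
    \<open>(1, 0)\<close> lies beyond both.\<close>
  define K where "K = {w :: real \<times> real. inner (1, 0) w \<le> 1/2} \<inter> {w. inner (2, -1) w \<le> 0}"
  have "straight_drawing (insert z V) (add_vertex x y z E) ((\<lambda>v. L (p v))(z := (1, 0)))"
  proof (rule straight_drawing_add_vertex[OF d])
    show "convex K" unfolding K_def by (intro convex_Int convex_halfspace_le)
    show "(\<lambda>v. L (p v)) ` V \<subseteq> K"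
      using pv by (auto simp: K_def L_def inner_prod_def)
    show "(1, 0) \<notin> K" by (simp add: K_def)
    show "closed_segment (L (p x)) (1, 0) \<inter> K \<subseteq> {L (p x)}"
      unfolding px by (auto simp: K_def in_segment zero_prod_def)
    show "closed_segment (L (p y)) (1, 0) \<inter> K \<subseteq> {L (p y)}"
    proof
      fix w assume w: "w \<in> closed_segment (L (p y)) (1, 0) \<inter> K"
      then obtain u where u: "0 \<le> u" "w = ((1 - u) / 2 + u, 1 - u)" by (auto simp: px in_segment)
      moreover have "fst w \<le> 1/2" using w by (simp add: K_def inner_prod_def)
      ultimately have "u = 0" by (simp add: field_simps)
      then show "w \<in> {L (p y)}" using u px by simp
    qed
    show "closed_segment (L (p x)) (1, 0) \<inter> closed_segment (L (p y)) (1, 0) \<subseteq> {(1, 0)}"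
      unfolding px by (auto simp: in_segment)
  qed
  moreover have "0 < fst (L (p v)) \<and> fst (L (p v)) < 1 \<and> 0 < snd (L (p v))" if "v \<in> V" "v \<noteq> x" for v
  proof (cases "v = y")
    case True
    then show ?thesis using px by simp
  next
    case False
    then have "0 < fst (p v) \<and> fst (p v) < 1 \<and> 0 < snd (p v)"
      using that assms unfolding based_drawing_def by blast
    then show ?thesis by (simp add: L_def)
  qed
  ultimately have "based_drawing (insert z V) (add_vertex x y z E) x z ((\<lambda>v. L (p v))(z := (1, 0)))"
    using fresh(1,2) px unfolding based_drawing_def by auto
  then show ?thesis by blast
qed

lemma based_drawing_keep:
  assumes "based_drawing V E x y p"
  shows "\<exists>p'. based_drawing (insert z V) (add_vertex x y z E) x y p'"
proof -
  have d: "straight_drawing V E p" and px: "p x = (0, 0)" "p y = (1, 0)"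
    using assms by (auto simp: based_drawing_def)
  have "finite V" using E by (simp add: edges_on_def)
  \<comment> \<open>The two quotients are the steepnesses at which a vertex is seen from
    \<open>x\<close> and from \<open>y\<close>. At these two vertices themselves both quotients are
    0, as \<open>snd\<close> vanishes there.\<close>
  then have "bdd_above ((\<lambda>v. max (snd (p v) / fst (p v)) (snd (p v) / (1 - fst (p v)))) ` V)" by simp
  then obtain M0 where M0: "\<And>v. v \<in> V \<Longrightarrow> max (snd (p v) / fst (p v)) (snd (p v) / (1 - fst (p v))) \<le> M0"
    unfolding bdd_above_def by auto
  define M where "M = max M0 1"
  have M: "0 < M" by (simp add: M_def)
  have pv: "snd (p v) \<le> M * fst (p v) \<and> snd (p v) \<le> M * (1 - fst (p v))" if v: "v \<in> V" for v
  proof (cases "v = x \<or> v = y")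
    case True
    then show ?thesis using px M by auto
  next
    case False
    then have "0 < fst (p v)" "fst (p v) < 1" using assms v by (auto simp: based_drawing_def)
    moreover have "snd (p v) / fst (p v) \<le> M" "snd (p v) / (1 - fst (p v)) \<le> M"
      using M0[OF v] by (auto simp: M_def)
    ultimately show ?thesis by (simp add: pos_divide_le_eq)
  qed
  \<comment> \<open>The region below the lines of slope \<open>M\<close> through \<open>p x\<close>
    and \<open>- M\<close> through \<open>p y\<close>. The new segments from \<open>(1/2, M)\<close>
    have slopes \<open>2 * M\<close> and \<open>- 2 * M\<close>, so they leave \<open>K\<close>
    immediately.\<close>
  define K where "K = {w :: real \<times> real. inner (-M, 1) w \<le> 0} \<inter> {w. inner (M, 1) w \<le> M}"
  have "straight_drawing (insert z V) (add_vertex x y z E) (p(z := (1/2, M)))"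
  proof (rule straight_drawing_add_vertex[OF d])
    show "convex K" unfolding K_def by (intro convex_Int convex_halfspace_le)
    show "p ` V \<subseteq> K" using pv by (auto simp: K_def inner_prod_def algebra_simps)
    show "(1/2, M) \<notin> K" using M by (simp add: K_def)
    show "closed_segment (p x) (1/2, M) \<inter> K \<subseteq> {p x}"
      unfolding px using M by (auto simp: K_def in_segment zero_prod_def mult_le_0_iff)
    show "closed_segment (p y) (1/2, M) \<inter> K \<subseteq> {p y}"
    proof
      fix w assume w: "w \<in> closed_segment (p y) (1/2, M) \<inter> K"
      then obtain u where u: "0 \<le> u" "w = (1 - u / 2, u * M)" by (auto simp: px in_segment)
      then have "M * u \<le> 0" using w by (simp add: K_def inner_prod_def algebra_simps)
      then have "u = 0" using M u by (simp add: mult_le_0_iff)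
      then show "w \<in> {p y}" using u px by simp
    qed
    show "closed_segment (p x) (1/2, M) \<inter> closed_segment (p y) (1/2, M) \<subseteq> {(1/2, M)}"
    proof
      fix w assume w: "w \<in> closed_segment (p x) (1/2, M) \<inter> closed_segment (p y) (1/2, M)"
      then obtain u where u: "u \<le> 1" "w = (u / 2, u * M)" by (auto simp: px in_segment)
      obtain u' where u': "u' \<le> 1" "w = (1 - u' / 2, u' * M)" using w by (auto simp: px in_segment)
      have "u = 1" using u u' by simp
      then show "w \<in> {(1/2, M)}" using u by simp
    qed
  qed
  moreover have "0 < fst (p v) \<and> fst (p v) < 1 \<and> 0 < snd (p v)" if "v \<in> V" "v \<noteq> x" "v \<noteq> y" for v
    using assms that unfolding based_drawing_def by blast
  ultimately have "based_drawing (insert z V) (add_vertex x y z E) x y (p(z := (1/2, M)))"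
    using fresh(1,2) px M unfolding based_drawing_def by auto
  then show ?thesis by blast
qed

end

section \<open>Contraction and deletion\<close>

lemma spanning_trees_delete:
  assumes "wf_multigraph G" "mg_verts G \<noteq> {}"
  shows "spanning_trees (delete_edge G e) = {T \<in> spanning_trees G. e \<notin> T}"
proof -
  have "wf_multigraph (delete_edge G e)" "mg_verts (delete_edge G e) \<noteq> {}"
    using assms by (auto simp: wf_multigraph_def delete_edge_def)
  note spanning_trees_eq[OF this] spanning_trees_eq[OF assms]
  then show ?thesis by (auto simp: delete_edge_def)
qed

text \<open>Contraction identifies only the ends of \<open>e\<close>, and these are joined when
  \<open>e\<close> is available. So walks project to the contraction, and walks there lift after
  inserting passages along \<open>e\<close>.\<close>

lemma edges_connect_contract:
  assumes e: "mg_ends G e = {x, y}"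
    and T: "\<And>f. f \<in> T \<Longrightarrow> card (mg_ends G f) \<in> {1, 2}"
  shows "edges_connect (mg_verts (contract_edge G e)) (mg_ends (contract_edge G e)) T \<longleftrightarrow>
    edges_connect (mg_verts G) (mg_ends G) (insert e T)"
proof -
  let ?c = "contract_vertex G e"
  let ?R = "(adj_rel (mg_ends G) (insert e T))\<^sup>*"
  let ?S = "(adj_rel (mg_ends (contract_edge G e)) T)\<^sup>*"
  have "(x, y) \<in> ?R" using e by (auto simp: adj_rel_def)
  then have xy: "(x, y) \<in> ?R" "(y, x) \<in> ?R" by (auto intro: adj_rel_rtrancl_sym)
  have same: "(u, v) \<in> ?R" if "?c u = ?c v" for u v
    using that xy e unfolding contract_vertex_def by (auto split: if_splits)
  have "(?c u, ?c v) \<in> ?S" if uv: "(u, v) \<in> adj_rel (mg_ends G) (insert e T)" for u v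
  proof -
    obtain f where f: "f \<in> insert e T" "mg_ends G f = {u, v}" using uv by (auto simp: adj_rel_def)
    show ?thesis
    proof (cases "f = e")
      case True
      then have "?c u = ?c v" using f by (simp add: contract_vertex_def)
      then show ?thesis by simp
    next
      case False
      then have "f \<in> T" "mg_ends (contract_edge G e) f = {?c u, ?c v}"
        using f by (auto simp: contract_edge_def)
      then show ?thesis unfolding adj_rel_def by blast
    qed
  qed
  then have down: "(?c u, ?c v) \<in> ?S" if "(u, v) \<in> ?R" for u v
    using that rtrancl_map_rtrancl by metis
  \<comment> \<open>The claim is for every representative \<open>v\<close> of the end block, so that
    the induction may switch to the vertex at which the next edge starts.\<close>
  have up: "(u, v) \<in> ?R" if "(?c u, Y) \<in> ?S" "Y = ?c v" for u v Y
    using that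
  proof (induction arbitrary: v rule: rtrancl_induct)
    case base
    then show ?case using same by simp
  next
    case (step X Y)
    from step.hyps(2) obtain f where f: "f \<in> T" "?c ` mg_ends G f = {X, Y}"
      by (auto simp: adj_rel_def contract_edge_def)
    have "X \<in> ?c ` mg_ends G f" "Y \<in> ?c ` mg_ends G f" using f by auto
    then obtain a b where ab: "a \<in> mg_ends G f" "X = ?c a" "b \<in> mg_ends G f" "Y = ?c b" by blast
    obtain a' b' where "mg_ends G f = {a', b'}" using T[OF f(1)] by (rule ends_eq_doubleton)
    then have "a = b \<or> mg_ends G f = {a, b}" using ab by auto
    then have "(a, b) \<in> ?R" using f(1) by (auto simp: adj_rel_def)
    moreover have "(u, a) \<in> ?R" using step.IH ab by simp
    moreover have "(b, v) \<in> ?R" using same ab step.prems by simp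
    ultimately show ?case by (meson rtrancl_trans)
  qed
  have verts: "mg_verts (contract_edge G e) = ?c ` mg_verts G" by (simp add: contract_edge_def)
  show ?thesis unfolding edges_connect_def verts using up down by blast
qed

lemma card_verts_contract:
  assumes "mg_ends G e = {x, y}" "x \<noteq> y" "{x, y} \<subseteq> mg_verts G" "finite (mg_verts G)"
  shows "card (mg_verts (contract_edge G e)) + 1 = card (mg_verts G)"
proof -
  have "mg_verts (contract_edge G e) = insert {x, y} ((\<lambda>v. {v}) ` (mg_verts G - {x, y}))"
    using assms by (auto simp: contract_edge_def contract_vertex_def)
  moreover have "{x, y} \<notin> (\<lambda>v. {v}) ` (mg_verts G - {x, y})" by auto
  moreover have "card (mg_verts G - {x, y}) + 2 = card (mg_verts G)"
    using assms card_Diff_subset[of "{x, y}" "mg_verts G"] card_mono[of "mg_verts G" "{x, y}"] by simp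
  ultimately show ?thesis using assms by (simp add: card_image)
qed

text \<open>Inserting \<open>e\<close> is a bijection from the trees of the contraction onto the
  trees that contain \<open>e\<close>. Labels are kept, so edges that become parallel stay
  distinct.\<close>

lemma num_spanning_trees_contract:
  assumes wf: "wf_multigraph G" and e: "e \<in> mg_edges G" "card (mg_ends G e) = 2"
  shows "num_spanning_trees (contract_edge G e) = card {T \<in> spanning_trees G. e \<in> T}"
proof -
  let ?H = "contract_edge G e"
  obtain x y where xy: "mg_ends G e = {x, y}" "x \<noteq> y" using e(2) by (auto simp: card_2_iff)
  have sub: "{x, y} \<subseteq> mg_verts G" and fin: "finite (mg_verts G)" "finite (mg_edges G)"
    using wf e xy by (auto simp: wf_multigraph_def)
  have ends: "card (mg_ends G f) \<in> {1, 2}" if "f \<in> mg_edges G" for f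
    using wf that by (simp add: wf_multigraph_def)
  have wfH: "wf_multigraph ?H"
    unfolding wf_multigraph_def
  proof (intro conjI ballI)
    show "finite (mg_verts ?H)" "finite (mg_edges ?H)" using fin by (simp_all add: contract_edge_def)
    fix f assume "f \<in> mg_edges ?H"
    then have f: "f \<in> mg_edges G" by (simp add: contract_edge_def)
    then show "mg_ends ?H f \<subseteq> mg_verts ?H"
      using wf by (auto simp: wf_multigraph_def contract_edge_def)
    obtain a b where "mg_ends G f = {a, b}" using ends[OF f] by (rule ends_eq_doubleton)
    then show "card (mg_ends ?H f) \<in> {1, 2}" by (auto simp: contract_edge_def card_insert_if)
  qed
  have nV: "mg_verts G \<noteq> {}" "mg_verts ?H \<noteq> {}" using sub by (auto simp: contract_edge_def)
  have edges: "mg_edges ?H = mg_edges G - {e}" by (simp add: contract_edge_def)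
  have iff: "T \<in> spanning_trees ?H \<longleftrightarrow> e \<notin> T \<and> insert e T \<in> spanning_trees G" for T
  proof (cases "T \<subseteq> mg_edges G - {e}")
    case True
    then have "finite T" using fin by (auto intro: finite_subset)
    then have "card (insert e T) = card T + 1" using True by (subst card_insert_disjoint) auto
    moreover have "edges_connect (mg_verts ?H) (mg_ends ?H) T \<longleftrightarrow>
        edges_connect (mg_verts G) (mg_ends G) (insert e T)"
      using True ends by (intro edges_connect_contract[OF xy(1)]) auto
    moreover have "insert e T \<subseteq> mg_edges G" "e \<notin> T" using True e by auto
    ultimately show ?thesis
      using card_verts_contract[OF xy sub fin(1)] True
      unfolding spanning_trees_eq[OF wf nV(1)] spanning_trees_eq[OF wfH nV(2)] edges by auto
  next
    case False
    then show ?thesis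
      unfolding spanning_trees_eq[OF wf nV(1)] spanning_trees_eq[OF wfH nV(2)] edges by auto
  qed
  have "bij_betw (insert e) (spanning_trees ?H) {T \<in> spanning_trees G. e \<in> T}"
  proof (rule bij_betw_byWitness[where f' = "\<lambda>T. T - {e}"])
    show "(\<lambda>T. T - {e}) ` {T \<in> spanning_trees G. e \<in> T} \<subseteq> spanning_trees ?H"
      by (auto simp: iff insert_absorb)
  qed (auto simp: iff)
  then show ?thesis unfolding num_spanning_trees_def by (rule bij_betw_same_card)
qed

section \<open>Feasible vectors\<close>

lemma planar_straight_drawing:
  fixes V :: "nat set"
  assumes E: "edges_on V E" and p: "straight_drawing V E p"
  shows "planar \<lparr>mg_verts = V, mg_edges = set_encode ` E, mg_ends = set_decode\<rparr>"
proof -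
  \<comment> \<open>Edges are labelled by the binary code of their endpoint set; \<open>Min\<close>
    and \<open>Max\<close> choose a direction in which to draw the segment.\<close>
  define c where "c k = linepath (p (Min (set_decode k))) (p (Max (set_decode k)))" for k
  have Ef: "finite f" "f \<subseteq> V" "card f = 2" if "f \<in> E" for f
    using that E card.infinite[of f] by (auto simp: edges_on_def intro: finite_subset)
  have c: "simple_path (c (set_encode f)) \<and>
      {pathstart (c (set_encode f)), pathfinish (c (set_encode f))} = p ` f \<and>
      path_image (c (set_encode f)) = convex hull (p ` f)" if f: "f \<in> E" for f
  proof -
    obtain a b where ab: "f = {a, b}" "a < b"
      using Ef(3)[OF f] by (auto simp: card_2_iff) (metis insert_commute linorder_neqE_nat)
    have "c (set_encode f) = linepath (p a) (p b)"
      unfolding c_def set_encode_inverse[OF Ef(1)[OF f]] using ab by simp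
    moreover have "p a \<noteq> p b"
      using p Ef(2)[OF f] ab unfolding straight_drawing_def inj_on_def by auto
    ultimately show ?thesis using ab by (simp add: segment_convex_hull simple_path_linepath)
  qed
  have dec: "set_decode (set_encode f) = f" if "f \<in> E" for f using Ef(1)[OF that] by simp
  have inj: "inj_on p V" and p1: "\<And>f v. f \<in> E \<Longrightarrow> v \<in> V \<Longrightarrow> p v \<in> convex hull (p ` f) \<Longrightarrow> v \<in> f"
    and p2: "\<And>f g. f \<in> E \<Longrightarrow> g \<in> E \<Longrightarrow> f \<noteq> g \<Longrightarrow> convex hull (p ` f) \<inter> convex hull (p ` g) \<subseteq> p ` f \<inter> p ` g"
    using p unfolding straight_drawing_def by blast+
  have hull: "convex hull (p ` f) \<inter> p ` V = p ` f" if "f \<in> E" for f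
    using p1[OF that] Ef(2)[OF that] hull_subset[of "p ` f" convex] by blast
  have "plane_drawing \<lparr>mg_verts = V, mg_edges = set_encode ` E, mg_ends = set_decode\<rparr> p c"
    unfolding plane_drawing_def multigraph.simps
  proof (intro conjI ballI impI inj)
    fix k assume "k \<in> set_encode ` E"
    then obtain f where f: "f \<in> E" "k = set_encode f" by blast
    show "simple_path (c k)" "{pathstart (c k), pathfinish (c k)} = p ` set_decode k"
      "path_image (c k) \<inter> p ` V = p ` set_decode k"
      using c[OF f(1)] hull[OF f(1)] dec[OF f(1)] f(2) by simp_all
    fix l assume "l \<in> set_encode ` E" and kl: "k \<noteq> l"
    then obtain g where g: "g \<in> E" "l = set_encode g" by blast
    have "f \<noteq> g" using f g kl by auto
    then show "path_image (c k) \<inter> path_image (c l) \<subseteq> p ` set_decode k \<inter> p ` set_decode l"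
      using p2[OF f(1) g(1)] c[OF f(1)] c[OF g(1)] dec[OF f(1)] dec[OF g(1)] f(2) g(2) by simp
  qed
  then show ?thesis unfolding planar_def by blast
qed

text \<open>\<open>set_encode\<close> turns the set-based graph into one with natural numbers as
  edge labels; it is injective on \<open>E\<close>, so it carries trees to trees and preserves all
  counts.\<close>

lemma planar_feasible_edge_vector:
  fixes V :: "nat set"
  assumes E: "edges_on V E" and e: "e \<in> E" and p: "straight_drawing V E p" and n: "card V \<le> n"
  shows "planar_feasible n (edge_vector V E e)"
proof -
  let ?G = "\<lparr>mg_verts = V, mg_edges = set_encode ` E, mg_ends = set_decode\<rparr>"
  let ?e = "set_encode e"
  have Ef: "finite f" "f \<subseteq> V" "card f = 2" if "f \<in> E" for f
    using that E by (auto simp: edges_on_def intro: finite_subset)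
  have dec: "set_decode (set_encode f) = f" if "f \<in> E" for f using Ef(1)[OF that] by simp
  have inj: "inj_on set_encode E" using Ef(1) inj_on_set_encode by (auto simp: inj_on_def)
  have wf: "wf_multigraph ?G"
    using E edges_on_finite[OF E] Ef dec by (auto simp: wf_multigraph_def edges_on_def)
  have simple: "simple_graph ?G"
    unfolding simple_graph_def using wf Ef(3) dec by (auto simp: inj_on_def)
  have nV: "mg_verts ?G \<noteq> {}" using Ef[OF e] by auto
  have adj: "adj_rel set_decode (set_encode ` T) = adj_rel id T" if "T \<subseteq> E" for T
    using that dec by (auto simp: adj_rel_def)
  have cardT: "card (set_encode ` T) = card T" if "T \<subseteq> E" for T
    using inj that by (metis card_image inj_on_subset)
  have st: "spanning_trees ?G = (`) set_encode ` trees V E"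
    unfolding spanning_trees_eq[OF wf nV] multigraph.simps
  proof (intro equalityI subsetI)
    fix T assume T: "T \<in> {T. T \<subseteq> set_encode ` E \<and> edges_connect V set_decode T \<and> card T + 1 = card V}"
    then obtain S where S: "S \<subseteq> E" "T = set_encode ` S" by (auto simp: subset_image_iff)
    then have "S \<in> trees V E"
      using T adj[OF S(1)] cardT[OF S(1)] by (simp add: trees_def edges_connect_def)
    then show "T \<in> (`) set_encode ` trees V E" using S by blast
  next
    fix T assume "T \<in> (`) set_encode ` trees V E"
    then obtain S where S: "S \<in> trees V E" "T = set_encode ` S" by blast
    then have "S \<subseteq> E" by (simp add: trees_def)
    then show "T \<in> {T. T \<subseteq> set_encode ` E \<and> edges_connect V set_decode T \<and> card T + 1 = card V}"
      using S adj[of S] cardT[of S] by (auto simp: trees_def edges_connect_def)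
  qed
  have mem: "?e \<in> set_encode ` T \<longleftrightarrow> e \<in> T" if "T \<in> trees V E" for T
    using that e inj by (auto simp: trees_def inj_on_def)
  have injT: "inj_on ((`) set_encode) (trees V E)"
    using inj_on_image_Pow[OF inj] by (rule inj_on_subset) (auto simp: trees_def)
  have "{T \<in> spanning_trees ?G. ?e \<in> T} = (`) set_encode ` {T \<in> trees V E. e \<in> T}"
    "{T \<in> spanning_trees ?G. ?e \<notin> T} = (`) set_encode ` {T \<in> trees V E. e \<notin> T}"
    unfolding st using mem by auto
  moreover have "card ((`) set_encode ` {T \<in> trees V E. P T}) = card {T \<in> trees V E. P T}" for P
    by (rule card_image) (rule inj_on_subset[OF injT], auto)
  ultimately have "edge_vector V E e = (int (num_spanning_trees (contract_edge ?G ?e)),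
      int (num_spanning_trees (delete_edge ?G ?e)))"
    using num_spanning_trees_contract[OF wf, of ?e] e dec[OF e] Ef(3)[OF e]
      spanning_trees_delete[OF wf nV, of ?e]
    by (simp add: edge_vector_def num_spanning_trees_def)
  then show ?thesis
    unfolding planar_feasible_def using simple planar_straight_drawing[OF E p] n e
    by (intro exI[of _ ?G] exI[of _ ?e]) simp
qed

lemma num_spanning_trees_le:
  "finite (mg_edges G) \<Longrightarrow> num_spanning_trees G \<le> 2 ^ card (mg_edges G)"
  unfolding num_spanning_trees_def spanning_trees_def card_Pow[symmetric]
  by (intro card_mono) auto

text \<open>Since \<open>card\<close> of an infinite set is 0, the final lower bound needs
  finiteness. At most \<open>2 ^ n\<close> edges are possible, as endpoint sets are distinct, and
  this bounds both tree counts.\<close>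

lemma finite_planar_feasible: "finite {v. planar_feasible n v}"
proof (rule finite_subset)
  let ?B = "2 ^ 2 ^ n :: nat"
  show "{v. planar_feasible n v} \<subseteq> {0..int ?B} \<times> {0..int ?B}"
  proof
    fix v assume "v \<in> {v. planar_feasible n v}"
    then obtain G :: "(nat, nat) multigraph" and e where G: "simple_graph G" "card (mg_verts G) \<le> n"
      and v: "v = (int (num_spanning_trees (contract_edge G e)), int (num_spanning_trees (delete_edge G e)))"
      unfolding planar_feasible_def by blast
    have fin: "finite (mg_verts G)" "finite (mg_edges G)"
      using G by (auto simp: simple_graph_def wf_multigraph_def)
    have "card (mg_edges G) \<le> card (Pow (mg_verts G))"
      using G fin by (intro card_inj_on_le[of "mg_ends G"]) (auto simp: simple_graph_def wf_multigraph_def)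
    also have "\<dots> \<le> 2 ^ n" using fin G by (simp add: card_Pow)
    finally have m: "card (mg_edges G - {e}) \<le> 2 ^ n"
      using card_mono[of "mg_edges G" "mg_edges G - {e}"] fin by force
    have "num_spanning_trees (delete_edge G e) \<le> 2 ^ card (mg_edges G - {e})"
      using num_spanning_trees_le[of "delete_edge G e"] fin by (simp add: delete_edge_def)
    moreover have "num_spanning_trees (contract_edge G e) \<le> 2 ^ card (mg_edges G - {e})"
      using num_spanning_trees_le[of "contract_edge G e"] fin by (simp add: contract_edge_def)
    moreover have "(2::nat) ^ card (mg_edges G - {e}) \<le> ?B" using m by (intro power_increasing) auto
    ultimately have "num_spanning_trees (delete_edge G e) \<le> ?B" "num_spanning_trees (contract_edge G e) \<le> ?B"
      using le_trans by blast+
    then show "v \<in> {0..int ?B} \<times> {0..int ?B}"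
      unfolding v mem_Times_iff fst_conv snd_conv atLeastAtMost_iff of_nat_le_iff by simp
  qed
qed simp

section \<open>Vectors realized together with a drawing that can be extended\<close>

text \<open>The index counts vertices beyond the first two. The based drawing is part of the
  invariant because the next vertex is attached along the base.\<close>

definition realizable :: "nat \<Rightarrow> int \<times> int \<Rightarrow> bool" where
  "realizable n v \<longleftrightarrow> (\<exists>(V :: nat set) E x y p. edges_on V E \<and> x \<noteq> y \<and> {x, y} \<in> E \<and>
     card V \<le> n + 2 \<and> edge_vector V E {x, y} = v \<and> based_drawing V E x y p)"

lemma realizable_imp_planar_feasible: "realizable n v \<Longrightarrow> planar_feasible (n + 2) v"
  unfolding realizable_def based_drawing_def using planar_feasible_edge_vector by blast

lemma realizable_mono:
  assumes "realizable m v" "m \<le> n"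
  shows "realizable n v"
proof -
  obtain V :: "nat set" and E x y p where "edges_on V E" "x \<noteq> y" "{x, y} \<in> E" "card V \<le> m + 2"
    "edge_vector V E {x, y} = v" "based_drawing V E x y p"
    using assms(1) unfolding realizable_def by blast
  moreover from this have "card V \<le> n + 2" using assms(2) by simp
  ultimately show ?thesis unfolding realizable_def by blast
qed

lemma realizable_single_edge: "realizable 0 (1, 0)"
proof -
  let ?V = "{0, 1 :: nat}" and ?E = "{{0, 1 :: nat}}"
  define p :: "nat \<Rightarrow> real \<times> real" where "p v = (if v = 0 then (0, 0) else (1, 0))" for v
  have "adj_rel id ?E = {(0, 1), (1, 0)}"
    by (auto simp: adj_rel_def doubleton_eq_iff)
  then have "edges_connect ?V id ?E" by (auto simp: edges_connect_def)
  then have "trees ?V ?E = {?E}" by (auto simp: trees_def subset_singleton_iff)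
  then have ev: "{T \<in> trees ?V ?E. {0, 1} \<in> T} = {?E}" "{T \<in> trees ?V ?E. {0, 1} \<notin> T} = {}" by auto
  have "edge_vector ?V ?E {0, 1} = (1, 0)" unfolding edge_vector_def ev by simp
  moreover have "edges_on ?V ?E" by (simp add: edges_on_def)
  moreover have "based_drawing ?V ?E 0 1 p"
    by (auto simp: based_drawing_def straight_drawing_def p_def inj_on_def)
  ultimately show ?thesis
    unfolding realizable_def
    by (intro exI[of _ ?V] exI[of _ ?E] exI[of _ 0] exI[of _ 1] exI[of _ p]) simp
qed

text \<open>These are \<open>S\<close>, \<open>P\<close> and \<open>D\<close>. The first two make
  \<open>{x, z}\<close> the new base, \<open>S\<close> after removing \<open>{x, y}\<close>; the
  third keeps \<open>{x, y}\<close> as base.\<close>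

lemma realizable_steps:
  assumes "realizable n (t, u)"
  shows "realizable (Suc n) (t + u, u)"
    and "realizable (Suc n) (2 * t + u, t + u)"
    and "realizable (Suc n) (2 * t, t + 2 * u)"
proof -
  obtain V :: "nat set" and E x y p where E: "edges_on V E" "x \<noteq> y" "{x, y} \<in> E"
    and V: "card V \<le> n + 2" and ev: "edge_vector V E {x, y} = (t, u)" and p: "based_drawing V E x y p"
    using assms unfolding realizable_def by blast
  have fin: "finite V" using E by (simp add: edges_on_def)
  then obtain z where z: "z \<notin> V" using ex_new_if_finite infinite_UNIV_nat by blast
  interpret ear V E x y z using E z by unfold_locales
  let ?V = "insert z V" and ?E = "add_vertex x y z E"
  have card: "card ?V \<le> Suc n + 2" using V fin z by simp
  have xz: "x \<noteq> z" using fresh by blast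
  have in_E: "{x, z} \<in> ?E" "{x, y} \<in> ?E" "{x, z} \<in> ?E - {{x, y}}"
    using xy fresh by (auto simp: add_vertex_def)
  obtain q where q: "based_drawing ?V ?E x z q" using based_drawing_swap[OF p] by blast
  obtain r where r: "based_drawing ?V ?E x y r" using based_drawing_keep[OF p] by blast
  have q': "based_drawing ?V (?E - {{x, y}}) x z q"
    using q straight_drawing_subset[of ?V ?E q "?E - {{x, y}}"] by (auto simp: based_drawing_def)
  have on': "edges_on ?V (?E - {{x, y}})" using edges_on_add_vertex edges_on_subset by blast
  note ev' = edge_vectors_add_vertex[OF ev]
  show "realizable (Suc n) (t + u, u)"
    unfolding realizable_def using on' xz in_E(3) card ev'(3) q' by blast
  show "realizable (Suc n) (2 * t + u, t + u)"
    unfolding realizable_def using edges_on_add_vertex xz in_E(1) card ev'(1) q by blast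
  show "realizable (Suc n) (2 * t, t + 2 * u)"
    unfolding realizable_def using edges_on_add_vertex xy(1) in_E(2) card ev'(2) r by blast
qed

section \<open>A family of Pell size\<close>

text \<open>The operation \<open>S\<close>; \<open>triangle_vec\<close> is \<open>P\<close>, and
  \<open>two_vertex_vec\<close> is \<open>Q\<close>.\<close>

fun subdivide_vec :: "int \<times> int \<Rightarrow> int \<times> int" where
  "subdivide_vec (t, u) = (t + u, u)"

fun triangle_vec :: "int \<times> int \<Rightarrow> int \<times> int" where
  "triangle_vec (t, u) = (2 * t + u, t + u)"

text \<open>The three cases are \<open>D (P (1, 0))\<close>, \<open>P (D (D (t - u, u)))\<close> and \<open>D (S (t, u))\<close>.\<close>

fun two_vertex_vec :: "int \<times> int \<Rightarrow> int \<times> int" where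
  "two_vertex_vec (t, u) =
     (if u = 0 then (4, 4)
      else if t > 2 * u then (12 * t - 8 * u, 8 * t - 4 * u)
      else (2 * t + 2 * u, t + 3 * u))"

text \<open>The two vectors at level one are \<open>S (1, 0) = (1, 0)\<close> and
  \<open>P (1, 0) = (2, 1)\<close>.\<close>

fun vectors :: "nat \<Rightarrow> (int \<times> int) set" where
  "vectors 0 = {(1, 0)}"
| "vectors (Suc 0) = {(1, 0), (2, 1)}"
| "vectors (Suc (Suc n)) = subdivide_vec ` vectors (Suc n) \<union> triangle_vec ` vectors (Suc n)
     \<union> two_vertex_vec ` vectors n"

text \<open>Excluding \<open>(1, 1)\<close> is essential: it would be mapped by \<open>S\<close> to \<open>(2, 1) = P (1, 0)\<close>, and by the
  third operation to \<open>(4, 4)\<close>.\<close>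

definition admissible :: "(int \<times> int) set" where
  "admissible = insert (1, 0) {(t, u). 1 \<le> u \<and> u \<le> t \<and> 2 \<le> t}"

lemma vectors_admissible: "vectors n \<subseteq> admissible"
proof (induction n rule: vectors.induct)
  case (3 n)
  have "subdivide_vec v \<in> admissible" "triangle_vec v \<in> admissible" "two_vertex_vec v \<in> admissible"
    if "v \<in> admissible" for v
    using that by (cases v; auto simp: admissible_def)+
  then show ?case unfolding vectors.simps using 3 by blast
qed (auto simp: admissible_def)

section \<open>Injectivity and disjointness of the three operations\<close>

lemma inj_on_subdivide_vec: "inj_on subdivide_vec A"
  by (auto simp: inj_on_def)

lemma inj_on_triangle_vec: "inj_on triangle_vec A"
  by (auto simp: inj_on_def)

text \<open>Each linear branch has nonzero determinant. The branch for \<open>t > 2 * u\<close> has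
  ratios above 4/3, the last one at most 6/5, and \<open>(4, 4)\<close> would need
  \<open>(1, 1)\<close> in the last branch, which is not admissible.\<close>

lemma inj_on_two_vertex_vec: "inj_on two_vertex_vec admissible"
proof (rule inj_onI)
  fix v w assume vw: "v \<in> admissible" "w \<in> admissible" "two_vertex_vec v = two_vertex_vec w"
  obtain t u a b where v: "v = (t, u)" and w: "w = (a, b)" by (cases v; cases w)
  have "t = 1 \<and> u = 0 \<or> 1 \<le> u \<and> u \<le> t \<and> 2 \<le> t" "a = 1 \<and> b = 0 \<or> 1 \<le> b \<and> b \<le> a \<and> 2 \<le> a"
    using vw(1,2) by (auto simp: v w admissible_def)
  moreover have "(if u = 0 then (4, 4) else if t > 2 * u then (12 * t - 8 * u, 8 * t - 4 * u)
      else (2 * t + 2 * u, t + 3 * u)) = (if b = 0 then (4, 4) else if a > 2 * b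
      then (12 * a - 8 * b, 8 * a - 4 * b) else (2 * a + 2 * b, a + 3 * b))"
    using vw(3) by (simp only: v w two_vertex_vec.simps)
  ultimately have "t = a \<and> u = b" by (elim disjE conjE) (simp_all split: if_splits)
  then show "v = w" by (simp add: v w)
qed

lemma subdivide_vec_bounds:
  assumes "v \<in> admissible" "subdivide_vec v = (t, u)"
  shows "2 * u \<le> t" "t = 2 * u \<Longrightarrow> u \<noteq> 1"
  using assms by (cases v; auto simp: admissible_def)+

lemma triangle_vec_bounds:
  assumes "v \<in> admissible" "triangle_vec v = (t, u)"
  shows "3 * u \<le> 2 * t" "t \<le> 2 * u" "t = 2 * u \<Longrightarrow> u = 1"
  using assms by (cases v; auto simp: admissible_def)+

lemma two_vertex_vec_bounds:
  assumes "v \<in> admissible" "two_vertex_vec v = (t, u)"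
  shows "0 < u" "2 * t < 3 * u"
  using assms by (cases v; auto simp: admissible_def split: if_splits)+

text \<open>The images of \<open>S\<close> and \<open>P\<close> could meet only at ratio 2, where
  \<open>P\<close> yields just \<open>(2, 1)\<close> and \<open>S\<close> never yields it. The third
  image lies below ratio 3/2.\<close>

lemma images_disjoint:
  "subdivide_vec ` admissible \<inter> triangle_vec ` admissible = {}"
  "(subdivide_vec ` admissible \<union> triangle_vec ` admissible) \<inter> two_vertex_vec ` admissible = {}"
proof -
  have "subdivide_vec a \<noteq> triangle_vec b" if "a \<in> admissible" "b \<in> admissible" for a b
  proof
    assume eq: "subdivide_vec a = triangle_vec b"
    obtain t u where tu: "triangle_vec b = (t, u)" by (cases "triangle_vec b")
    note s = subdivide_vec_bounds[OF that(1) eq[unfolded tu]] and t = triangle_vec_bounds[OF that(2) tu]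
    have "t = 2 * u" using s(1) t(2) by linarith
    then show False using s(2) t(3) by blast
  qed
  then show "subdivide_vec ` admissible \<inter> triangle_vec ` admissible = {}" by blast
  have "subdivide_vec a \<noteq> two_vertex_vec b \<and> triangle_vec a \<noteq> two_vertex_vec b"
    if "a \<in> admissible" "b \<in> admissible" for a b
  proof -
    obtain t u where tu: "two_vertex_vec b = (t, u)" by (cases "two_vertex_vec b")
    note two = two_vertex_vec_bounds[OF that(2) tu]
    have "subdivide_vec a \<noteq> (t, u)" using subdivide_vec_bounds(1)[OF that(1), of t u] two by linarith
    moreover have "triangle_vec a \<noteq> (t, u)" using triangle_vec_bounds(1)[OF that(1), of t u] two by linarith
    ultimately show ?thesis unfolding tu by blast
  qed
  then show "(subdivide_vec ` admissible \<union> triangle_vec ` admissible) \<inter> two_vertex_vec ` admissible = {}"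
    by blast
qed

section \<open>Pell recurrence and closed form\<close>

lemma finite_vectors: "finite (vectors n)"
  by (induction n rule: vectors.induct) auto

lemma card_vectors_Suc_Suc:
  "card (vectors (Suc (Suc n))) = 2 * card (vectors (Suc n)) + card (vectors n)"
proof -
  let ?A = "subdivide_vec ` vectors (Suc n)" and ?B = "triangle_vec ` vectors (Suc n)"
    and ?C = "two_vertex_vec ` vectors n"
  have sub: "?A \<subseteq> subdivide_vec ` admissible" "?B \<subseteq> triangle_vec ` admissible"
    "?C \<subseteq> two_vertex_vec ` admissible"
    using vectors_admissible by (auto intro!: image_mono)
  have "?A \<inter> ?B = {}" "(?A \<union> ?B) \<inter> ?C = {}" using sub images_disjoint by blast+
  then have "card (vectors (Suc (Suc n))) = card ?A + card ?B + card ?C"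
    by (simp add: card_Un_disjoint finite_vectors)
  moreover have "card ?C = card (vectors n)"
    by (rule card_image) (rule inj_on_subset[OF inj_on_two_vertex_vec vectors_admissible])
  ultimately show ?thesis by (simp add: card_image inj_on_subdivide_vec inj_on_triangle_vec)
qed

text \<open>The numbers \<open>1 + sqrt 2\<close> and \<open>1 - sqrt 2\<close> are the roots of
  \<open>c ^ 2 = 2 * c + 1\<close>, so their powers satisfy the Pell recurrence.\<close>

lemma card_vectors:
  "real (card (vectors n)) = ((1 + sqrt 2) ^ (n + 1) - (1 - sqrt 2) ^ (n + 1)) / (2 * sqrt 2)"
proof (induction n rule: vectors.induct)
  case 1
  then show ?case by (simp add: field_simps)
next
  case 2
  then show ?case by (simp add: field_simps power2_eq_square)
next
  case (3 n)
  have rec: "c ^ (Suc (Suc n) + 1) = 2 * c ^ (Suc n + 1) + c ^ (n + 1)" if "c ^ 2 = 2 * c + 1" for c :: real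
  proof -
    have "c ^ (Suc (Suc n) + 1) = c ^ 2 * c ^ (n + 1)" by (simp add: power2_eq_square)
    also have "\<dots> = 2 * c ^ (Suc n + 1) + c ^ (n + 1)" unfolding that by (simp add: algebra_simps)
    finally show ?thesis .
  qed
  have "(1 + sqrt 2) ^ 2 = 2 * (1 + sqrt 2) + 1" "(1 - sqrt 2) ^ 2 = 2 * (1 - sqrt 2) + 1"
    by (simp_all add: power2_eq_square algebra_simps)
  note rec[OF this(1)] rec[OF this(2)]
  then show ?case unfolding card_vectors_Suc_Suc using 3 by (simp add: field_simps)
qed

section \<open>Every vector of the family is realizable\<close>

text \<open>Only \<open>S\<close> produces ratios above 2, so such a vector with
  \<open>u > 0\<close> can be traced back through \<open>S\<close> to the previous level.\<close>

lemma vectors_above_two: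
  assumes "(t, u) \<in> vectors n" "0 < u" "2 * u < t"
  shows "\<exists>m. n = Suc m \<and> (t - u, u) \<in> vectors m"
proof (cases n rule: vectors.cases)
  case (3 m)
  have adm: "a \<in> vectors k \<Longrightarrow> a \<in> admissible" for a k using vectors_admissible by blast
  from assms(1) 3 consider v where "v \<in> vectors (Suc m)" "(t, u) = subdivide_vec v"
    | v where "v \<in> vectors (Suc m)" "(t, u) = triangle_vec v"
    | v where "v \<in> vectors m" "(t, u) = two_vertex_vec v"
    by auto
  then show ?thesis
  proof cases
    case 1
    then show ?thesis using 3 by (cases v) auto
  next
    case (2 v)
    then show ?thesis using adm[of v] assms by (cases v) (auto simp: admissible_def)
  next
    case (3 v)
    then show ?thesis using adm[of v] assms by (cases v) (auto simp: admissible_def split: if_splits)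
  qed
qed (use assms in auto)

text \<open>Strong induction is used because the middle branch of \<open>two_vertex_vec\<close>
  undoes an \<open>S\<close> first and thus goes back three levels.\<close>

lemma realizable_vectors: "v \<in> vectors n \<Longrightarrow> realizable n v"
proof (induction n arbitrary: v rule: less_induct)
  case (less n)
  have two: "realizable 1 (2, 1)"
    using realizable_steps(2)[OF realizable_single_edge] by simp
  show ?case
  proof (cases n rule: vectors.cases)
    case 1
    then show ?thesis using less.prems realizable_single_edge by simp
  next
    case 2
    then show ?thesis using less.prems realizable_mono[OF realizable_single_edge] two by auto
  next
    case (3 m)
    from less.prems 3 consider w where "w \<in> vectors (Suc m)" "v = subdivide_vec w"
      | w where "w \<in> vectors (Suc m)" "v = triangle_vec w"
      | w where "w \<in> vectors m" "v = two_vertex_vec w"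
      by auto
    then show ?thesis
    proof cases
      case (1 w)
      then show ?thesis using less.IH[of "Suc m" w] realizable_steps(1) 3 by (cases w) auto
    next
      case (2 w)
      then show ?thesis using less.IH[of "Suc m" w] realizable_steps(2) 3 by (cases w) auto
    next
      case w: (3 w)
      obtain t u where tu: "w = (t, u)" by (cases w)
      have adm: "(t, u) \<in> admissible" using w(1) tu vectors_admissible by blast
      consider "u = 0" | "0 < u" "2 * u < t" | "0 < u" "t \<le> 2 * u"
        using adm by (fastforce simp: admissible_def)
      then show ?thesis
      proof cases
        case 1
        have "realizable 2 (4, 4)" using realizable_steps(3)[OF two] by (simp add: numeral_2_eq_2)
        then show ?thesis using realizable_mono[of 2 _ n] 1 w tu 3 by simp
      next
        case 2
        then obtain k where k: "m = Suc k" "(t - u, u) \<in> vectors k"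
          using vectors_above_two w tu by blast
        \<comment> \<open>With \<open>n = k + 3\<close>, the three steps \<open>D\<close>,
          \<open>D\<close>, \<open>P\<close> starting here use exactly the vertices
          available.\<close>
        then have "realizable k (t - u, u)" using less.IH 3 by simp
        from realizable_steps(2)[OF realizable_steps(3)[OF realizable_steps(3)[OF this]]]
        show ?thesis using 2 k 3 w tu by (simp add: algebra_simps)
      next
        case 3: 3
        have "realizable m (t, u)" using less.IH \<open>n = Suc (Suc m)\<close> w tu by simp
        from realizable_steps(3)[OF realizable_steps(1)[OF this]]
        show ?thesis using 3 w tu \<open>n = Suc (Suc m)\<close> by (simp add: algebra_simps)
      qed
    qed
  qed
qed

section \<open>From the Pell numbers to the floor bound\<close>

theorem theorem2p7:
  fixes n :: nat
  shows "\<lfloor>1 / (2 * sqrt 2) * (1 + sqrt 2) ^ (n + 1)\<rfloor>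
           \<le> int (card {v. planar_feasible (n + 2) v})"
proof -
  have "vectors n \<subseteq> {v. planar_feasible (n + 2) v}"
    using realizable_vectors realizable_imp_planar_feasible by blast
  then have le: "card (vectors n) \<le> card {v. planar_feasible (n + 2) v}"
    by (rule card_mono[OF finite_planar_feasible])
  \<comment> \<open>The conjugate root has absolute value at most 1, so its term in the closed form
    stays below 1 and the floor cannot exceed the Pell number.\<close>
  have "sqrt 2 \<le> 2" "1 \<le> sqrt (2::real)" by (auto intro: real_le_lsqrt)
  then have "\<bar>1 - sqrt 2\<bar> ^ (n + 1) \<le> 1" by (intro power_le_one) auto
  then have "(1 - sqrt 2) ^ (n + 1) \<le> 1"
    by (metis abs_le_D1 power_abs)
  moreover have "1 < 2 * sqrt (2::real)" using \<open>1 \<le> sqrt 2\<close> by linarith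
  ultimately have "(1 - sqrt 2) ^ (n + 1) / (2 * sqrt 2) < 1" by (simp add: divide_less_eq)
  moreover have "1 / (2 * sqrt 2) * (1 + sqrt 2) ^ (n + 1) =
      real (card (vectors n)) + (1 - sqrt 2) ^ (n + 1) / (2 * sqrt 2)"
    unfolding card_vectors by (simp add: diff_divide_distrib)
  ultimately have "1 / (2 * sqrt 2) * (1 + sqrt 2) ^ (n + 1) < real (card (vectors n)) + 1"
    by linarith
  then have "\<lfloor>1 / (2 * sqrt 2) * (1 + sqrt 2) ^ (n + 1)\<rfloor> \<le> int (card (vectors n))"
    by (simp only: floor_le_iff of_int_of_nat_eq)
  then show ?thesis using le by linarith
qed

end
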